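(* Consider the uncertain system $\dot x=Ax+Bu+D\xi(t,x,u)$, $y=Cx$, together with $N\ge n+1$ sliding mode observers $$\dot{\hat x}_i=A\hat x_i+Bu-G_l\tilde y_i+G_n\nu(\hat x_o),\qquad \tilde y_i=C\hat x_i-y,\qquad i=1,\dots,N,$$ $$\hat x_o=\sum_{i=1}^{N-1}\hat\alpha_i\hat x_i+\Big(1-\sum_{i=1}^{N-1}\hat\alpha_i\Big)\hat x_N,$$ and the modified recursive least squares algorithm for $\hat{\bar\alpha}=(\hat\alpha_1,\dots,\hat\alpha_{N-1})^T$, $$\dot{\hat{\bar\alpha}}=-R\,E^TC^T\big(CE\hat{\bar\alpha}+\tilde y_N\big),\qquad \dot R=-R\,E^TC^TCE\,R,\qquad \hat{\bar\alpha}(0)=\hat{\bar\alpha}_0,\quad R(0)=\mu I,$$ where $\mu>0$ is a constant and $E(t)\in\mathbb R^{n\times(N-1)}$ is the matrix whose $i$th column is $\hat x_i(t)-\hat x_N(t)$. If a nonsingular matrix $J$ transforming the system into the canonical form described in the context is considered, the design matrices are chosen as $$G_l=J^{-1}\begin{bmatrix}\mathcal A_{12}\\ \mathcal A_{22}-\mathcal A_{22}^s\end{bmatrix},\qquad G_n=\|\mathcal D_2\|J^{-1}\begin{bmatrix}0\\ I_p\end{bmatrix},$$ and $P_2$ satisfies $P_2\mathcal A_{22}^s+(\mathcal A_{22}^s)^TP_2=-Q_2$, then the observation error system (the dynamics of $\tilde x_o=\hat x_o-x$) is quadratically stable. Moreover, the $\hat x_i$, $i=1,\dots,N$, are uniformly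 ultimately bounded, and $\hat{\bar\alpha}$ and $R$ are bounded.
   Context: Plant: $x\in\mathbb R^n$ is the state, $u\in\mathbb R^m$ a bounded control input that stabilizes the system (so that $x$ is bounded), $y\in\mathbb R^p$ the output, and $\xi(t,x,u)\in\mathbb R^q$ an unknown function with $\|\xi(t,x,u)\|\le\overline\xi$. It is assumed that $p\ge q$ and that $B,C,D$ are full rank matrices. Standing assumptions: $\operatorname{rank}(CD)=q$, and all invariant zeros of $(A,D,C)$ lie in the open left half-plane, i.e. the Rosenbrock matrix $\begin{bmatrix} sI_n-A & D\\ C&0\end{bmatrix}$ has rank $n+q$ for all $s$ with nonnegative real part. Canonical form: there is a nonsingular matrix $J$ such that in the coordinates $Jx=(x_I,y)$, $x_I\in\mathbb R^{n-p}$, the system reads $$\dot x_I=\mathcal A_{11}x_I+\mathcal A_{12}y+\mathcal B_1u,\qquad \dot y=\mathcal A_{21}x_I+\mathcal A_{22}y+\mathcal B_2u+\mathcal D_2\xi,$$ with $\mathcal A_{11}$ a stable (Hurwitz) matrix; here $JAJ^{-1}=(\mathcal A_{ij})$, $JB=\begin{bmatrix}\mathcal B_1\\ \mathcal B_2\end{bmatrix}$, $JD=\begin{bmatrix}0\\ \mathcal D_2\end{bmatrix}$, $CJ^{-1}=[\,0\ \ I_p\,]$. Design data: $\mathcal A_{22}^s\in\mathbb R^{p\times p}$ is a chosen Hurwitz matrix, $Q_2\in\mathbb R^{p\times p}$ a chosen symmetric positive definite matrix, $P_2\in\mathbb R^{p\times p}$ is symmetric positive definite, and $\rho\ge\overline\xi+\gamma_0$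 with $\gamma_0>0$. With $\hat\alpha_N:=1-\sum_{i=1}^{N-1}\hat\alpha_i$, $$\nu(\hat x_o)=\begin{cases}-\rho\,\dfrac{P_2\sum_{i=1}^N\hat\alpha_i\tilde y_i}{\big\|P_2\sum_{i=1}^N\hat\alpha_i\tilde y_i\big\|}&\text{if }\sum_{i=1}^N\hat\alpha_i\tilde y_i\ne0,\\[2mm] 0&\text{otherwise.}\end{cases}$$
   Formalization: Quadratic stability with constant P from t=0 fails (adaptation can destabilise early); proved instead with V=φ(t)e^T P e, one P and rate for all runs, φ nonincreasing and equal to 1 after a finite time, with φ and that time depending on a bound for the initial differences of the observers. *)

theory Defs
  imports "HOL-Analysis.Analysis"
begin

text \<open>
  Matrices and block structure.  The new coordinates \<open>z = J x\<close> are indexed by the same type \<open>'n\<close>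
  as \<open>x\<close>.  An injection \<open>out :: 'p \<Rightarrow> 'n\<close> says which entries of \<open>z\<close> form the block \<open>y\<close>; the entries
  outside \<open>range out\<close> form the block \<open>x\<^sub>I\<close>.  In this way the block \<open>x\<^sub>I\<close> may be empty (\<open>n = p\<close>),
  which an index type of the form \<open>'r + 'p\<close> would exclude.
\<close>

definition principal_hurwitz :: "'n set \<Rightarrow> real^'n^'n \<Rightarrow> bool"
  \<comment> \<open>the principal submatrix of \<open>M\<close> with rows and columns in \<open>I\<close> has all eigenvalues in the open
      left half-plane; its eigenvectors are padded with zeros outside \<open>I\<close>\<close>
  where "principal_hurwitz I M \<longleftrightarrow>
    (\<forall>(s::complex) (v::complex^'n).
       v \<noteq> 0 \<and> (\<forall>i. i \<notin> I \<longrightarrow> v $ i = 0) \<and>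
       (\<forall>i\<in>I. (map_matrix complex_of_real M *v v) $ i = s * v $ i) \<longrightarrow> Re s < 0)"

definition hurwitz :: "real^'n^'n \<Rightarrow> bool"
  where "hurwitz M \<longleftrightarrow>
    (\<forall>(s::complex) (v::complex^'n).
       v \<noteq> 0 \<and> map_matrix complex_of_real M *v v = s *s v \<longrightarrow> Re s < 0)"

definition sym_pos_def :: "real^'n^'n \<Rightarrow> bool"
  where "sym_pos_def P \<longleftrightarrow> transpose P = P \<and> (\<forall>v. v \<noteq> 0 \<longrightarrow> v \<bullet> (P *v v) > 0)"

definition full_rank :: "real^'n^'m \<Rightarrow> bool"
  where "full_rank M \<longleftrightarrow> rank M = min CARD('n) CARD('m)"

definition rosenbrock ::
    "real^'n^'n \<Rightarrow> real^'q^'n \<Rightarrow> real^'n^'p \<Rightarrow> complex \<Rightarrow> complex^('n + 'q)^('n + 'p)"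
  where "rosenbrock A D C s = (\<chi> i j.
    (case (i, j) of
       (Inl k, Inl l) \<Rightarrow> (if k = l then s else 0) - complex_of_real (A $ k $ l)
     | (Inl k, Inr l) \<Rightarrow> complex_of_real (D $ k $ l)
     | (Inr k, Inl l) \<Rightarrow> complex_of_real (C $ k $ l)
     | (Inr k, Inr l) \<Rightarrow> 0))"

definition out_rows :: "('p \<Rightarrow> 'n) \<Rightarrow> real^'c^'n \<Rightarrow> real^'c^'p"
  where "out_rows out M = (\<chi> i. M $ out i)"

definition out_cols :: "('p \<Rightarrow> 'n) \<Rightarrow> real^'n^'r \<Rightarrow> real^'p^'r"
  where "out_cols out M = (\<chi> i j. M $ i $ out j)"

definition stack :: "('p \<Rightarrow> 'n) \<Rightarrow> real^'c^'n \<Rightarrow> real^'c^'p \<Rightarrow> real^'c^'n"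
  \<comment> \<open>the block column with upper block \<open>X\<close> and lower block \<open>Y\<close>; only the rows of \<open>X\<close> outside
      \<open>range out\<close> are used\<close>
  where "stack out X Y = (\<chi> i. if i \<in> range out then Y $ inv out i else X $ i)"

definition canonical_form ::
    "real^'n^'n \<Rightarrow> real^'q^'n \<Rightarrow> real^'n^'p \<Rightarrow> real^'n^'n \<Rightarrow> ('p \<Rightarrow> 'n) \<Rightarrow> bool"
  \<comment> \<open>\<open>C J\<^sup>-\<^sup>1 = [0 I]\<close>, \<open>J D = [0; D\<^sub>2]\<close>, and the block \<open>A\<^sub>1\<^sub>1\<close> of \<open>J A J\<^sup>-\<^sup>1\<close> is Hurwitz;
      the blocks of \<open>J B\<close> are unconstrained\<close>
  where "canonical_form A D C J out \<longleftrightarrow>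
    inj out \<and> invertible J \<and>
    C ** matrix_inv J = (\<chi> i j. if j = out i then 1 else 0) \<and>
    (\<forall>i. i \<notin> range out \<longrightarrow> (J ** D) $ i = 0) \<and>
    principal_hurwitz (- range out) (J ** A ** matrix_inv J)"

definition linear_gain ::
    "real^'n^'n \<Rightarrow> real^'n^'n \<Rightarrow> ('p \<Rightarrow> 'n) \<Rightarrow> real^'p^'p \<Rightarrow> real^'p^'n"
  \<comment> \<open>\<open>G\<^sub>l = J\<^sup>-\<^sup>1 [A\<^sub>1\<^sub>2; A\<^sub>2\<^sub>2 - A\<^sub>2\<^sub>2\<^sup>s]\<close>\<close>
  where "linear_gain A J out A22s =
    (let Acols = out_cols out (J ** A ** matrix_inv J)
     in matrix_inv J ** stack out Acols (out_rows out Acols - A22s))"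

definition switching_gain :: "real^'q^'n \<Rightarrow> real^'n^'n \<Rightarrow> ('p \<Rightarrow> 'n) \<Rightarrow> real^'p^'n"
  \<comment> \<open>\<open>G\<^sub>n = \<parallel>D\<^sub>2\<parallel> J\<^sup>-\<^sup>1 [0; I]\<close> with the matrix norm induced by the Euclidean norm; \<open>norm\<close> on
      matrices would be the Frobenius norm\<close>
  where "switching_gain D J out =
    onorm ((*v) (out_rows out (J ** D))) *\<^sub>R (matrix_inv J ** stack out 0 (mat 1))"

text \<open>
  The injection term \<open>\<nu>\<close> is discontinuous, so solutions are taken in the sense of Filippov.  As the
  same \<open>\<nu>\<close> enters all observers, and the output error on which it depends is a submersion of the
  closed-loop state when \<open>C\<close> has full row rank, regularising the closed-loop vector field amounts
  to regularising \<open>\<nu>\<close> and using a common selection in all observers.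
\<close>

definition injection :: "real^'p^'p \<Rightarrow> real \<Rightarrow> real^'p \<Rightarrow> real^'p"
  where "injection P2 \<rho> w = (if w \<noteq> 0 then (- \<rho> / norm (P2 *v w)) *\<^sub>R (P2 *v w) else 0)"

definition filippov :: "(real^'p \<Rightarrow> real^'p) \<Rightarrow> real^'p \<Rightarrow> (real^'p) set"
  where "filippov f w =
    (\<Inter>\<delta>\<in>{0<..}. \<Inter>S\<in>{S. negligible S}. closure (convex hull (f ` (ball w \<delta> - S))))"

definition caratheodory :: "(real \<Rightarrow> real^'n) \<Rightarrow> (real \<Rightarrow> real^'n) \<Rightarrow> bool"
  \<comment> \<open>\<open>z\<close> is locally absolutely continuous on \<open>[0,\<infinity>)\<close> with derivative \<open>g\<close> almost everywhere\<close>
  where "caratheodory z g \<longleftrightarrow>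
    (\<forall>t\<ge>0. g absolutely_integrable_on {0..t} \<and> z t = z 0 + integral {0..t} g)"

text \<open>
  The \<open>N\<close> observers are indexed by \<open>'k option\<close>, with \<open>CARD('k) = N - 1\<close>: \<open>Some i\<close> are the observers
  \<open>1, \<dots>, N - 1\<close> and \<open>None\<close> is observer \<open>N\<close>.
\<close>

definition weight :: "real^'k \<Rightarrow> 'k option \<Rightarrow> real"
  where "weight \<alpha> i = (case i of Some j \<Rightarrow> \<alpha> $ j | None \<Rightarrow> 1 - (\<Sum>j\<in>UNIV. \<alpha> $ j))"

definition combined :: "real^'k \<Rightarrow> ('k option \<Rightarrow> real^'n) \<Rightarrow> real^'n"
  where "combined \<alpha> v = (\<Sum>i\<in>UNIV. weight \<alpha> i *\<^sub>R v i)"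

definition differences :: "('k option \<Rightarrow> real^'n) \<Rightarrow> real^'k^'n"
  \<comment> \<open>the matrix \<open>E\<close>, whose column \<open>j\<close> is \<open>v\<^sub>j - v\<^sub>N\<close>\<close>
  where "differences v = (\<chi> i j. v (Some j) $ i - v None $ i)"

definition closed_loop ::
    "real^'n^'n \<Rightarrow> real^'m^'n \<Rightarrow> real^'n^'p \<Rightarrow> real^'q^'n \<Rightarrow> real^'p^'n \<Rightarrow> real^'p^'n \<Rightarrow>
     (real^'p \<Rightarrow> real^'p) \<Rightarrow> real \<Rightarrow>
     (real \<Rightarrow> real^'n \<Rightarrow> real^'m \<Rightarrow> real^'q) \<Rightarrow> (real \<Rightarrow> real^'m) \<Rightarrow>
     (real \<Rightarrow> real^'n) \<Rightarrow> ('k option \<Rightarrow> real \<Rightarrow> real^'n) \<Rightarrow> (real \<Rightarrow> real^'k) \<Rightarrow>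
     (real \<Rightarrow> real^'k^'k) \<Rightarrow> bool"
  where "closed_loop A B C D Gl Gn f \<mu> \<xi> u x xh \<alpha> R \<longleftrightarrow>
    (let yt = (\<lambda>i t. C *v xh i t - C *v x t);
         E = (\<lambda>t. differences (\<lambda>i. xh i t))
     in caratheodory x (\<lambda>t. A *v x t + B *v u t + D *v \<xi> t (x t) (u t)) \<and>
        (\<exists>\<nu>. (AE t in lebesgue. 0 \<le> t \<longrightarrow> \<nu> t \<in> filippov f (combined (\<alpha> t) (\<lambda>i. yt i t))) \<and>
             (\<forall>i. caratheodory (xh i)
                    (\<lambda>t. A *v xh i t + B *v u t - Gl *v yt i t + Gn *v \<nu> t))) \<and>
        (\<forall>t\<ge>0. (\<alpha> has_vector_derivative
                   - ((R t ** transpose (E t) ** transpose C) *v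
                        ((C ** E t) *v \<alpha> t + yt None t)))
                 (at t within {0..})) \<and>
        (\<forall>t\<ge>0. (R has_vector_derivative
                   - (R t ** transpose (E t) ** transpose C ** C ** E t ** R t))
                 (at t within {0..})) \<and>
        R 0 = \<mu> *\<^sub>R mat 1)"

definition closed_loop_runs ::
    "real^'n^'n \<Rightarrow> real^'m^'n \<Rightarrow> real^'n^'p \<Rightarrow> real^'q^'n \<Rightarrow> real^'p^'n \<Rightarrow> real^'p^'n \<Rightarrow>
     (real^'p \<Rightarrow> real^'p) \<Rightarrow> real \<Rightarrow> real \<Rightarrow>
     ((real \<Rightarrow> real^'n) \<times> ('k option \<Rightarrow> real \<Rightarrow> real^'n) \<times> (real \<Rightarrow> real^'k) \<times>
      (real \<Rightarrow> real^'k^'k)) set"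
  \<comment> \<open>all runs, over all initial states, all uncertainties bounded by \<open>\<xi>b\<close> and all bounded controls
      that keep the plant state bounded\<close>
  where "closed_loop_runs A B C D Gl Gn f \<mu> \<xi>b =
    {(x, xh, \<alpha>, R). \<exists>\<xi> u.
       (\<forall>t a b. norm (\<xi> t a b) \<le> \<xi>b) \<and> bounded (u ` {0..}) \<and> bounded (x ` {0..}) \<and>
       closed_loop A B C D Gl Gn f \<mu> \<xi> u x xh \<alpha> R}"

definition quadratically_stable :: "(real \<Rightarrow> (real \<Rightarrow> real^'n) set) \<Rightarrow> bool"
  \<comment> \<open>\<open>Z r\<close> is the set of trajectories whose time-varying dynamics have an initial transient of size
      at most \<open>r\<close>.  One matrix \<open>P\<close> and one rate \<open>\<epsilon>\<close> serve all trajectories, and the Lyapunov function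
      is \<open>V(t,e) = \<phi>(t) e\<^sup>T P e\<close>.  With \<open>\<phi> = 1\<close> this is the textbook definition for time-invariant
      uncertain systems; here it coincides with it from time \<open>T\<close> on.  The weight cannot be dropped
      before \<open>T\<close>: if the dynamics is time-varying and its frozen linear part at time \<open>0\<close> is not
      Hurwitz, no \<open>e\<^sup>T P e\<close> decreases from time \<open>0\<close> on.
      The last inequality is the integrated form of \<open>V' \<le> - \<epsilon> \<parallel>e\<parallel>\<^sup>2\<close>, meaningful for trajectories
      that are only absolutely continuous.\<close>
  where "quadratically_stable Z \<longleftrightarrow>
    (\<exists>P \<epsilon>. sym_pos_def P \<and> 0 < \<epsilon> \<and>
       (\<forall>r. \<exists>(\<phi>::real \<Rightarrow> real) T.
          0 \<le> T \<and> continuous_on {0..} \<phi> \<and> (\<forall>s t. 0 \<le> s \<and> s \<le> t \<longrightarrow> \<phi> t \<le> \<phi> s) \<and>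
          (\<forall>t\<ge>T. \<phi> t = 1) \<and>
          (\<forall>z\<in>Z r. \<forall>s t. 0 \<le> s \<and> s \<le> t \<longrightarrow>
             \<phi> t * (z t \<bullet> (P *v z t)) + \<epsilon> * integral {s..t} (\<lambda>\<tau>. (norm (z \<tau>))\<^sup>2)
               \<le> \<phi> s * (z s \<bullet> (P *v z s)))))"

definition uniformly_ultimately_bounded :: "(real \<Rightarrow> 'a::real_normed_vector) set \<Rightarrow> bool"
  \<comment> \<open>globally: the bound \<open>b\<close> does not depend on the size \<open>a\<close> of the state at the time \<open>t0\<close>\<close>
  where "uniformly_ultimately_bounded Z \<longleftrightarrow>
    (\<exists>b>0. \<forall>a>0. \<exists>T\<ge>0. \<forall>z\<in>Z. \<forall>t0\<ge>0. norm (z t0) \<le> a \<longrightarrow> (\<forall>t\<ge>t0 + T. norm (z t) \<le> b))"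

end

theory Submission
  imports Defs "HOL-Computational_Algebra.Fundamental_Theorem_Algebra"
begin

text \<open>
  Write \<open>A\<^sub>c = A - G\<^sub>l C\<close>.  In the canonical coordinates \<open>A\<^sub>c\<close> is block triangular with diagonal
  blocks \<open>A\<^sub>1\<^sub>1\<close> and \<open>A\<^sub>2\<^sub>2\<^sup>s\<close>, so a block diagonal \<open>P = diag(k P\<^sub>1, P\<^sub>2)\<close> with \<open>k\<close> large is a
  Lyapunov matrix for \<open>A\<^sub>c\<close>.  As \<open>e\<^sup>T P (G\<^sub>n \<nu> - D \<xi>)\<close> only sees the output block of \<open>P\<close>, it is nonpositive
  along Filippov solutions.  The injection \<open>\<nu>\<close> is common to all observers, hence the columns of \<open>E\<close>
  satisfy \<open>d' = A\<^sub>c d\<close> and decay exponentially.  The gain \<open>R\<close> is the inverse of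
  \<open>I/\<mu> + \<integral> E\<^sup>T C\<^sup>T C E\<close>, hence at most \<open>\<mu> I\<close>.  The combined error obeys
  \<open>e' = (A\<^sub>c - E R E\<^sup>T C\<^sup>T C) e + G\<^sub>n \<nu> - D \<xi>\<close>, where the time-varying perturbation decays exponentially; the
  weight \<open>\<phi>\<close> absorbs it before the time \<open>T\<close> from which it is dominated by the decay rate of \<open>A\<^sub>c\<close>.
  The control \<open>u\<close> cancels in the individual errors \<open>x\<^sub>i - x\<close>, which gives ultimate bounds that do not depend
  on the size of \<open>u\<close>.  Finally \<open>\<parallel>\<alpha>'\<parallel>\<close> is bounded by a decaying exponential, so \<open>\<alpha>\<close> is bounded.
\<close>

section \<open>Lyapunov matrices\<close>

text \<open>\<open>p(M) v\<close> by Horner's scheme. Only the action on vectors is used, so no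
  matrix powers have to be set up.\<close>

definition poly_apply :: "complex^'n^'n \<Rightarrow> complex poly \<Rightarrow> complex^'n \<Rightarrow> complex^'n"
  where "poly_apply M p v = fold_coeffs (\<lambda>a w. a *s v + M *v w) p 0"

lemma poly_apply_0 [simp]: "poly_apply M 0 v = 0"
  by (simp add: poly_apply_def)

lemma poly_apply_pCons [simp]: "poly_apply M (pCons a p) v = a *s v + M *v poly_apply M p v"
  by (cases "a = 0 \<and> p = 0") (auto simp: poly_apply_def)

lemma poly_apply_add: "poly_apply M (p + q) v = poly_apply M p v + poly_apply M q v"
  by (induction p q rule: poly_induct2) (simp_all add: algebra_simps matrix_vector_right_distrib vector_sadd_rdistrib)

lemma poly_apply_smult: "poly_apply M (smult c p) v = c *s poly_apply M p v"
  by (induction p) (simp_all add: vector_smult_assoc vector_add_ldistrib vector_scalar_commute)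

lemma poly_apply_vadd: "poly_apply M p (v + w) = poly_apply M p v + poly_apply M p w"
  by (induction p) (simp_all add: algebra_simps matrix_vector_right_distrib vector_add_ldistrib)

lemma poly_apply_scale: "poly_apply M p (c *s v) = c *s poly_apply M p v"
  by (induction p) (simp_all add: vector_smult_assoc vector_add_ldistrib vector_scalar_commute mult.commute)

lemma poly_apply_zero [simp]: "poly_apply M p 0 = 0"
  using poly_apply_scale[of M p 0 0] by simp

lemma poly_apply_mult: "poly_apply M (p * q) v = poly_apply M p (poly_apply M q v)"
  by (induction p) (simp_all add: poly_apply_add poly_apply_smult)

text \<open>\<open>M\<close> acts as the polynomial \<open>[:0, 1:]\<close>, so this is
  commutativity of polynomial multiplication.\<close>

lemma poly_apply_commute: "M *v poly_apply M p v = poly_apply M p (M *v v)"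
proof -
  have "[:0, 1:] * p = p * [:0, 1:]" by (rule mult.commute)
  then have "poly_apply M [:0, 1:] (poly_apply M p v) = poly_apply M p (poly_apply M [:0, 1:] v)"
    by (metis poly_apply_mult)
  then show ?thesis by simp
qed

lemma scaleR_eq_vector_scalar_mult: "r *\<^sub>R (w :: complex^'n) = complex_of_real r *s w"
  by (simp add: vec_eq_iff scaleR_conv_of_real[where 'a = complex])

lemma poly_apply_linear: "linear (poly_apply M p)"
proof (rule linearI)
  fix r v
  show "poly_apply M p (r *\<^sub>R v) = r *\<^sub>R poly_apply M p v"
    by (simp add: scaleR_eq_vector_scalar_mult poly_apply_scale)
qed (rule poly_apply_vadd)

text \<open>The Krylov vectors \<open>v\<close>, \<open>M v\<close>, \<open>M (M v)\<close>, ...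
  live in a space of finite real dimension, so one of them depends on its predecessors; the
  dependence is a monic polynomial that kills \<open>v\<close>.\<close>

lemma vector_annihilator:
  fixes M :: "complex^'n^'n"
  shows "\<exists>p. p \<noteq> 0 \<and> poly_apply M p v = 0"
proof -
  define w where "w k = poly_apply M (monom 1 k) v" for k
  have ex: "\<exists>k. w k \<in> span (w ` {..<k})"
  proof (rule ccontr)
    assume "\<not> ?thesis"
    then have ns: "w k \<notin> span (w ` {..<k})" for k by blast
    have "independent (w ` {..<k}) \<and> card (w ` {..<k}) = k" for k
    proof (induction k)
      case (Suc k)
      have "w k \<notin> w ` {..<k}" using ns[of k] span_base[of "w k" "w ` {..<k}"] by argo
      then show ?case using Suc ns[of k]
        by (simp add: lessThan_Suc independent_insert)
    qed (simp add: independent_empty)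
    from this[of "Suc DIM(complex^'n)"] show False
      using independent_bound by fastforce
  qed
  then obtain k where k: "w k \<in> span (w ` {..<k})" by blast
  \<comment> \<open>The condition on coefficients says that \<open>q\<close> has degree below
    \<open>k\<close> and still admits \<open>q = 0\<close> when \<open>k = 0\<close>. Subtracting
    such a \<open>q\<close> from the monomial of degree \<open>k\<close> leaves the leading
    coefficient \<open>1\<close>.\<close>
  define S where "S = {poly_apply M q v | q. \<forall>i\<ge>k. coeff q i = 0}"
  have "subspace S"
  proof (rule subspaceI)
    show "0 \<in> S" unfolding S_def by (intro CollectI exI[of _ 0]) auto
    fix x y assume "x \<in> S" "y \<in> S"
    then obtain p q where "x = poly_apply M p v" "y = poly_apply M q v"
      "\<forall>i\<ge>k. coeff p i = 0" "\<forall>i\<ge>k. coeff q i = 0" unfolding S_def by blast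
    then show "x + y \<in> S" unfolding S_def
      by (intro CollectI exI[of _ "p + q"]) (auto simp: poly_apply_add)
  next
    fix c :: real and x assume "x \<in> S"
    then obtain p where "x = poly_apply M p v" "\<forall>i\<ge>k. coeff p i = 0" unfolding S_def by blast
    then show "c *\<^sub>R x \<in> S" unfolding S_def
      by (intro CollectI exI[of _ "smult (of_real c) p"])
         (auto simp: poly_apply_smult scaleR_eq_vector_scalar_mult)
  qed
  moreover have "w ` {..<k} \<subseteq> S"
    unfolding S_def w_def by (auto intro!: exI[of _ "monom 1 _"])
  ultimately have "w k \<in> S"
    using k span_minimal by blast
  then obtain q where q: "w k = poly_apply M q v" "\<forall>i\<ge>k. coeff q i = 0" unfolding S_def by blast
  have "coeff (monom 1 k + smult (-1) q) k = 1" using q(2) by simp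
  then have "monom 1 k + smult (-1) q \<noteq> 0" by force
  moreover have "poly_apply M (monom 1 k + smult (-1) q) v = 0"
    using q(1) by (simp only: poly_apply_add poly_apply_smult w_def) simp
  ultimately show ?thesis by blast
qed

text \<open>The product of the annihilators of the basis vectors kills each basis vector, because
  the factors commute. This replaces the Cayley-Hamilton theorem.\<close>

lemma matrix_annihilator:
  fixes M :: "complex^'n^'n"
  shows "\<exists>p. p \<noteq> 0 \<and> (\<forall>v. poly_apply M p v = 0)"
proof -
  obtain q where q: "\<And>v. q v \<noteq> 0" "\<And>v. poly_apply M (q v) v = 0"
    using vector_annihilator[of M] by metis
  define p where "p = (\<Prod>i\<in>UNIV. q (axis i 1))"
  have p0: "poly_apply M p (axis i 1) = 0" for i
  proof -
    have "p = (\<Prod>j\<in>UNIV - {i}. q (axis j 1)) * q (axis i 1)"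
      unfolding p_def by (subst prod.remove[of UNIV i]) (auto simp: mult.commute)
    then show ?thesis by (simp add: poly_apply_mult q(2))
  qed
  have "poly_apply M p v = (\<Sum>i\<in>UNIV. v $ i *s poly_apply M p (axis i 1))" for v
  proof -
    have "v = (\<Sum>i\<in>UNIV. v $ i *s axis i 1)" by (rule basis_expansion[symmetric])
    then have "poly_apply M p v = poly_apply M p (\<Sum>i\<in>UNIV. v $ i *s axis i 1)" by simp
    also have "\<dots> = (\<Sum>i\<in>UNIV. poly_apply M p (v $ i *s axis i 1))"
      by (rule linear_sum[OF poly_apply_linear])
    finally show ?thesis by (simp add: poly_apply_scale)
  qed
  then have "poly_apply M p v = 0" for v by (simp add: p0)
  moreover have "p \<noteq> 0" unfolding p_def using q(1) by simp
  ultimately show ?thesis by blast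
qed

text \<open>An annihilating polynomial splits into linear factors over the complex numbers. If
  \<open>Re z\<close> is not negative then \<open>z\<close> is no eigenvalue, so
  \<open>M - z\<close> is injective and its factor can be cancelled.\<close>

lemma hurwitz_annihilator:
  fixes M :: "real^'n^'n"
  assumes "hurwitz M"
  shows "\<exists>zs. (\<forall>z\<in>set zs. Re z < 0) \<and>
    (\<forall>v. poly_apply (map_matrix complex_of_real M) (\<Prod>z\<leftarrow>zs. [:- z, 1:]) v = 0)"
proof -
  let ?M = "map_matrix complex_of_real M"
  let ?p = "\<lambda>zs. \<Prod>z\<leftarrow>zs. [:- z, 1:]"
  \<comment> \<open>The cofactor \<open>q\<close> collects the factors that are kept, so the next
    factor always stands in front and can be examined.\<close>
  have cancel: "(\<forall>v. poly_apply ?M (?p zs * q) v = 0) \<Longrightarrow> 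
      (\<forall>v. poly_apply ?M (?p (filter (\<lambda>z. Re z < 0) zs) * q) v = 0)" for zs q
  proof (induction zs arbitrary: q)
    case (Cons z zs)
    show ?case
    proof (cases "Re z < 0")
      case True
      have "poly_apply ?M (?p zs * ([:- z, 1:] * q)) v = 0" for v
        using Cons.prems by (simp only: list.map prod_list.Cons mult.assoc mult.left_commute)
      with Cons.IH[of "[:- z, 1:] * q"] True show ?thesis
        by (simp only: filter.simps if_True list.map prod_list.Cons mult.assoc mult.left_commute) blast
    next
      case False
      have "poly_apply ?M (?p zs * q) v = 0" for v
      proof -
        have "poly_apply ?M [:- z, 1:] (poly_apply ?M (?p zs * q) v) = 0"
          using Cons.prems by (simp only: list.map prod_list.Cons poly_apply_mult)
        then have "?M *v poly_apply ?M (?p zs * q) v = z *s poly_apply ?M (?p zs * q) v"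
          by (simp add: vec_eq_iff)
        then show ?thesis
          using assms False unfolding hurwitz_def by blast
      qed
      with Cons.IH[of q] False show ?thesis by simp
    qed
  qed simp
  obtain p where p: "p \<noteq> 0" "\<And>v. poly_apply ?M p v = 0"
    using matrix_annihilator by blast
  obtain Z where Z: "p = smult (lead_coeff p) (\<Prod>x\<in>#Z. [:-x, 1:])"
    using alg_closed_imp_factorization[OF p(1)] by blast
  obtain zs where "mset zs = Z" using ex_mset by blast
  then have "p = smult (lead_coeff p) (?p zs)"
    using Z by (metis mset_map prod_mset_prod_list)
  then have "lead_coeff p *s poly_apply ?M (?p zs) v = 0" for v
    using p(2)[of v] poly_apply_smult by metis
  then have "\<forall>v. poly_apply ?M (?p zs * 1) v = 0"
    using p(1) by simp
  from cancel[OF this] show ?thesis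
    by (intro exI[of _ "filter (\<lambda>z. Re z < 0) zs"]) simp
qed

section \<open>Gram matrices and the Lyapunov inequality\<close>

lemma inner_transpose: "x \<bullet> (A *v y) = (transpose A *v x) \<bullet> y" for A :: "real^'n^'m"
  by (simp add: transpose_matrix_vector dot_lmul_matrix)

lemma inner_transpose_left: "x \<bullet> (transpose A *v y) = (A *v x) \<bullet> y" for A :: "real^'n^'m"
  using inner_transpose[of x "transpose A" y] by (simp only: transpose_transpose)

lemma transpose_eq_selfI:
  fixes S :: "real^'n^'n"
  assumes "\<And>v w. v \<bullet> (S *v w) = (S *v v) \<bullet> w"
  shows "transpose S = S"
proof -
  have "transpose S *v v = S *v v" for v
    using assms[of v] by (metis inner_transpose vector_eq_rdot)
  then show ?thesis by (simp add: matrix_eq)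
qed

text \<open>\<open>S\<close> is the matrix of \<open>adjoint g \<circ> g\<close>. It lets a squared
  norm in a complex space serve as a real quadratic form on the state space.\<close>

lemma gram_matrix:
  fixes g :: "real^'n \<Rightarrow> 'b::euclidean_space"
  assumes "linear g"
  shows "\<exists>S. transpose S = S \<and> (\<forall>v w. v \<bullet> (S *v w) = g v \<bullet> g w)"
proof -
  define S where "S = matrix (adjoint g \<circ> g)"
  have "linear (adjoint g \<circ> g)"
    using adjoint_linear[OF assms] assms by (simp add: linear_compose)
  then have "S *v w = adjoint g (g w)" for w
    unfolding S_def by (simp add: matrix_works linear_matrix_vector_mul_eq)
  then have *: "v \<bullet> (S *v w) = g v \<bullet> g w" for v w
    using adjoint_works[OF assms] by simp
  then have "transpose S = S"
    by (intro transpose_eq_selfI) (metis inner_commute)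
  with * show ?thesis by blast
qed

text \<open>
  If \<open>(M - z\<^sub>1) \<cdots> (M - z\<^sub>m) = 0\<close> and \<open>w\<^sub>k = (M - z\<^sub>1) \<cdots> (M - z\<^sub>k) v\<close>, then \<open>w\<^sub>k' = z\<^sub>k\<^sub>+\<^sub>1 w\<^sub>k + w\<^sub>k\<^sub>+\<^sub>1\<close>
  along \<open>v' = M v\<close>, so a sum of \<open>\<parallel>w\<^sub>k\<parallel>\<^sup>2\<close> with rapidly growing weights is a Lyapunov function.  This
  avoids the matrix exponential and the Jordan form; the induction carries the error term that the
  last \<open>w\<^sub>k\<close> leaves.
\<close>

lemma gram_chain:
  fixes M :: "real^'n^'n"
  defines "cM \<equiv> map_matrix complex_of_real M"
  assumes "\<forall>z\<in>set zs. Re z < 0"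
  shows "\<exists>P c. transpose P = P \<and> (\<forall>v. 0 \<le> v \<bullet> (P *v v)) \<and> 0 \<le> c \<and>
    (\<forall>v. v \<bullet> (P *v (M *v v)) \<le> - (norm v)\<^sup>2 +
       c * (norm (poly_apply cM (\<Prod>z\<leftarrow>zs. [:- z, 1:]) (\<chi> i. complex_of_real (v $ i))))\<^sup>2)"
  using assms(2)
proof (induction zs)
  case Nil
  show ?case
    \<comment> \<open>The empty product acts as the identity, so with \<open>P = 0\<close> and
      \<open>c = 1\<close> both sides are zero.\<close>
    by (rule exI[of _ 0], rule exI[of _ 1]) (auto simp: norm_vec_def transpose_def vec_eq_iff one_pCons)
next
  case (Cons z zs)
  let ?cv = "\<lambda>v::real^'n. (\<chi> i. complex_of_real (v $ i)) :: complex^'n"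
  define p where "p = (\<Prod>z\<leftarrow>zs. [:- z, 1:])"
  define w where "w v = poly_apply cM p (?cv v)" for v
  define w' where "w' v = poly_apply cM ([:- z, 1:] * p) (?cv v)" for v
  from Cons obtain P c where P: "transpose P = P" "\<And>v. 0 \<le> v \<bullet> (P *v v)" and c: "0 \<le> c"
    and le: "\<And>v. v \<bullet> (P *v (M *v v)) \<le> - (norm v)\<^sup>2 + c * (norm (w v))\<^sup>2"
    unfolding w_def p_def by auto
  have "linear ?cv"
    by (intro linearI) (auto simp: vec_eq_iff scaleR_conv_of_real[where 'a = complex])
  then have "linear w"
    unfolding w_def using linear_compose[OF _ poly_apply_linear] by (auto simp: o_def)
  then obtain S where S: "transpose S = S" "\<And>u v. u \<bullet> (S *v v) = w u \<bullet> w v"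
    using gram_matrix by blast
  define a where "a = - Re z"
  have "a > 0" using Cons.prems by (simp add: a_def)
  \<comment> \<open>Half of the decay of the new term, \<open>k * a / 2\<close>, equals
    \<open>c\<close> and cancels the error left by the shorter chain.\<close>
  define k where "k = 2 * c / a"
  have "k \<ge> 0" using c \<open>a > 0\<close> by (simp add: k_def)
  have cM: "cM *v ?cv v = ?cv (M *v v)" for v
    by (simp add: cM_def vec_eq_iff matrix_vector_mult_def)
  have w': "w (M *v v) = z *s w v + w' v" for v
  proof -
    have "w' v = - z *s w v + cM *v w v"
      unfolding w'_def w_def poly_apply_mult by simp
    moreover have "cM *v w v = w (M *v v)"
      by (simp add: w_def poly_apply_commute cM)
    ultimately show ?thesis by (simp add: vec_eq_iff)
  qed
  \<comment> \<open>The inner product on a complex vector space is the real part of the Hermitian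
    one, so only \<open>Re z\<close> survives.\<close>
  have zi: "u \<bullet> (z *s u) = - a * (norm u)\<^sup>2" for u :: "complex^'n"
  proof -
    have "u $ i \<bullet> (z * u $ i) = - a * (u $ i \<bullet> u $ i)" for i
      by (simp add: inner_complex_def a_def algebra_simps)
    then show ?thesis
      by (simp add: inner_vec_def power2_norm_eq_inner sum_distrib_left sum_negf)
  qed
  have "v \<bullet> ((P + k *\<^sub>R S) *v (M *v v)) \<le> - (norm v)\<^sup>2 + k / (2 * a) * (norm (w' v))\<^sup>2" for v
  proof -
    \<comment> \<open>Young's inequality: the cross term uses up half of the decay \<open>a\<close>
      and shifts the rest of the error to \<open>w'\<close>.\<close>
    have "0 \<le> (a * norm (w v) - norm (w' v))\<^sup>2" by simp
    then have "2 * a * (norm (w v) * norm (w' v)) \<le> a * (a * (norm (w v))\<^sup>2) + (norm (w' v))\<^sup>2"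
      by (simp add: power2_eq_square algebra_simps)
    then have amgm: "norm (w v) * norm (w' v) \<le> a / 2 * (norm (w v))\<^sup>2 + 1 / (2 * a) * (norm (w' v))\<^sup>2"
      using \<open>a > 0\<close> by (simp add: field_simps)
    have "w v \<bullet> w (M *v v) \<le> - a * (norm (w v))\<^sup>2 + norm (w v) * norm (w' v)"
      using norm_cauchy_schwarz[of "w v" "w' v"] by (simp add: w' inner_add_right zi)
    also have "\<dots> \<le> - (a / 2) * (norm (w v))\<^sup>2 + 1 / (2 * a) * (norm (w' v))\<^sup>2"
      using amgm by simp
    finally have "k * (w v \<bullet> w (M *v v)) \<le> k * (- (a / 2) * (norm (w v))\<^sup>2 + 1 / (2 * a) * (norm (w' v))\<^sup>2)"
      using \<open>k \<ge> 0\<close> by (rule mult_left_mono)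
    also have "\<dots> = - c * (norm (w v))\<^sup>2 + k / (2 * a) * (norm (w' v))\<^sup>2"
      using \<open>a > 0\<close> by (simp add: k_def field_simps)
    finally show ?thesis
      using le[of v] by (simp add: matrix_vector_mult_add_rdistrib inner_add_right S(2)
          scaleR_matrix_vector_assoc[symmetric])
  qed
  moreover have "transpose (P + k *\<^sub>R S) = P + k *\<^sub>R S"
    using P(1) S(1) by (simp add: transpose_def vec_eq_iff)
  moreover have "0 \<le> v \<bullet> ((P + k *\<^sub>R S) *v v)" for v
    using P(2)[of v] \<open>k \<ge> 0\<close> by (simp add: matrix_vector_mult_add_rdistrib inner_add_right S(2)
          scaleR_matrix_vector_assoc[symmetric])
  ultimately show ?case
    using \<open>k \<ge> 0\<close> \<open>a > 0\<close> unfolding w'_def p_def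
    by (intro exI[of _ "P + k *\<^sub>R S"] exI[of _ "k / (2 * a)"]) auto
qed

text \<open>For an annihilating product the error term of \<open>gram_chain\<close> vanishes. The
  matrix obtained there is only semidefinite; adding \<open>h\<close> times the identity makes it
  definite, and \<open>h\<close> is so small that at most half of the decay is lost.\<close>

lemma hurwitz_lyapunov:
  fixes M :: "real^'n^'n"
  assumes "hurwitz M"
  shows "\<exists>P. sym_pos_def P \<and> (\<forall>v. v \<bullet> (P *v (M *v v)) \<le> - (norm v)\<^sup>2 / 2)"
proof -
  obtain zs where "\<forall>z\<in>set zs. Re z < 0"
    "\<And>v. poly_apply (map_matrix complex_of_real M) (\<Prod>z\<leftarrow>zs. [:- z, 1:]) v = 0"
    using hurwitz_annihilator[OF assms] by blast
  with gram_chain[of zs M] obtain P where P: "transpose P = P" "\<And>v. 0 \<le> v \<bullet> (P *v v)"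
    "\<And>v. v \<bullet> (P *v (M *v v)) \<le> - (norm v)\<^sup>2"
    by auto
  define k where "k = onorm ((*v) M)"
  have k: "norm (M *v v) \<le> k * norm v" for v
    unfolding k_def by (rule onorm) simp
  have "k \<ge> 0" unfolding k_def by (rule onorm_pos_le) simp
  define h where "h = 1 / (2 * (k + 1))"
  have h: "h > 0" "h * k \<le> 1 / 2" using \<open>k \<ge> 0\<close> by (auto simp: h_def field_simps)
  have eq: "v \<bullet> ((P + h *\<^sub>R mat 1) *v w) = v \<bullet> (P *v w) + h * (v \<bullet> w)" for v w
    by (simp add: matrix_vector_mult_add_rdistrib inner_add_right scaleR_matrix_vector_assoc[symmetric])
  have "sym_pos_def (P + h *\<^sub>R mat 1)"
    unfolding sym_pos_def_def
  proof (intro conjI allI impI)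
    show "transpose (P + h *\<^sub>R mat 1) = P + h *\<^sub>R mat 1"
      using P(1) by (simp add: transpose_def vec_eq_iff mat_def)
    show "v \<bullet> ((P + h *\<^sub>R mat 1) *v v) > 0" if "v \<noteq> 0" for v
      using P(2)[of v] h(1) that by (simp add: eq add_nonneg_pos)
  qed
  moreover have "v \<bullet> ((P + h *\<^sub>R mat 1) *v (M *v v)) \<le> - (norm v)\<^sup>2 / 2" for v
  proof -
    have "v \<bullet> (M *v v) \<le> norm v * (k * norm v)"
      by (rule order_trans[OF norm_cauchy_schwarz]) (simp add: k mult_left_mono)
    then have "h * (v \<bullet> (M *v v)) \<le> h * (norm v * (k * norm v))"
      using h(1) by (simp add: mult_left_mono)
    also have "\<dots> = (h * k) * (norm v)\<^sup>2" by (simp add: power2_eq_square)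
    also have "\<dots> \<le> 1 / 2 * (norm v)\<^sup>2" using h(2) by (rule mult_right_mono) simp
    finally show ?thesis using P(3)[of v] by (simp add: eq)
  qed
  ultimately show ?thesis by blast
qed

lemma
  assumes "invertible (A :: real^'n^'n)"
  shows matrix_inv_right: "A ** matrix_inv A = mat 1" and matrix_inv_left: "matrix_inv A ** A = mat 1"
  using someI_ex[OF assms[unfolded invertible_def]] by (simp_all add: matrix_inv_def)

section \<open>Coercive forms and the Lyapunov matrix of the canonical form\<close>

text \<open>The constant is the minimum on the unit sphere, extended by homogeneity.
  \<open>S\<close> is arbitrary because the lemma is also applied to \<open>- (P ** Ac)\<close>,
  which need not be symmetric.\<close>

lemma quadratic_form_coercive:
  fixes S :: "real^'n^'n"
  assumes "\<And>v. v \<noteq> 0 \<Longrightarrow> v \<bullet> (S *v v) > 0"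
  shows "\<exists>c>0. \<forall>v. c * (norm v)\<^sup>2 \<le> v \<bullet> (S *v v)"
proof -
  let ?q = "\<lambda>v. v \<bullet> (S *v v)"
  have cont: "continuous_on (sphere 0 1) ?q"
    by (intro continuous_intros linear_continuous_on) simp
  obtain b :: "real^'n" where "b \<in> Basis" using nonempty_Basis by blast
  then have "sphere 0 1 \<noteq> ({} :: (real^'n) set)" by (auto intro: norm_Basis)
  with continuous_attains_inf[OF compact_sphere _ cont] obtain m where
    m: "norm m = 1" "\<And>v. norm v = 1 \<Longrightarrow> ?q m \<le> ?q v" by auto
  have "?q m * (norm v)\<^sup>2 \<le> ?q v" for v
  proof (cases "v = 0")
    case False
    define u where "u = (1 / norm v) *\<^sub>R v"
    have "norm u = 1" using False by (simp add: u_def)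
    have v: "v = norm v *\<^sub>R u" using False by (simp add: u_def)
    have "?q v = (norm v)\<^sup>2 * ?q u"
      by (subst (1 2) v) (simp add: matrix_vector_mult_scaleR power2_eq_square)
    then show ?thesis using m(2)[OF \<open>norm u = 1\<close>] by (simp add: mult.commute mult_right_mono)
  qed simp
  moreover have "?q m > 0" using m(1) by (intro assms) auto
  ultimately show ?thesis by blast
qed

lemma quadratic_form_bounded:
  fixes S :: "real^'n^'m"
  shows "\<exists>c>0. \<forall>v w. \<bar>v \<bullet> (S *v w)\<bar> \<le> c * norm v * norm w"
proof (intro exI conjI allI)
  let ?c = "onorm ((*v) S) + 1"
  show "?c > 0" using onorm_pos_le[of "(*v) S"] by simp
  fix v w
  have "\<bar>v \<bullet> (S *v w)\<bar> \<le> norm v * norm (S *v w)" by (rule Cauchy_Schwarz_ineq2)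
  also have "\<dots> \<le> norm v * (?c * norm w)"
    using onorm[of "(*v) S" w] by (intro mult_left_mono) (auto simp: algebra_simps intro: order_trans)
  finally show "\<bar>v \<bullet> (S *v w)\<bar> \<le> ?c * norm v * norm w" by (simp add: mult_ac)
qed

text \<open>The completed matrix is block diagonal with an additional block \<open>- I\<close>. An
  eigenvector with a nonzero entry outside \<open>I\<close> forces \<open>s = - 1\<close>; any other
  is a padded eigenvector of the principal submatrix. Thus the Lyapunov lemma for full matrices also
  covers the block, even an empty one.\<close>

lemma principal_hurwitz_completion:
  fixes M :: "real^'n^'n"
  assumes "principal_hurwitz I M"
  shows "hurwitz (\<chi> i j. if i \<in> I \<and> j \<in> I then M $ i $ j else if i = j then - 1 else 0)"
    (is "hurwitz ?M")
  unfolding hurwitz_def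
proof (intro allI impI)
  fix s :: complex and v :: "complex^'n"
  assume "v \<noteq> 0 \<and> map_matrix complex_of_real ?M *v v = s *s v"
  then have v: "v \<noteq> 0" and eq: "(map_matrix complex_of_real ?M *v v) $ i = s * v $ i" for i
    by (auto simp: vec_eq_iff)
  show "Re s < 0"
  proof (cases "\<exists>i. i \<notin> I \<and> v $ i \<noteq> 0")
    case True
    then obtain i where i: "i \<notin> I" "v $ i \<noteq> 0" by blast
    have "(map_matrix complex_of_real ?M *v v) $ i = (\<Sum>j\<in>UNIV. complex_of_real (if i = j then - 1 else 0) * v $ j)"
      using i(1) by (simp add: matrix_vector_mult_def)
    also have "\<dots> = (\<Sum>j\<in>UNIV. if i = j then - v $ j else 0)"
      by (rule sum.cong) auto
    finally have "(map_matrix complex_of_real ?M *v v) $ i = \<dots>" .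
    then have "- v $ i = s * v $ i" using eq[of i] by simp
    then have "(s + 1) * v $ i = 0" unfolding distrib_right by (metis add.left_inverse mult_1)
    then have "s = - 1" using i(2) by (simp add: add_eq_0_iff2)
    then show ?thesis by simp
  next
    case False
    have "(map_matrix complex_of_real M *v v) $ i = s * v $ i" if "i \<in> I" for i
    proof -
      have "(map_matrix complex_of_real M *v v) $ i = (map_matrix complex_of_real ?M *v v) $ i"
        using False that unfolding matrix_vector_mult_def by (auto intro!: sum.cong)
      then show ?thesis using eq by simp
    qed
    then show ?thesis
      using assms v False unfolding principal_hurwitz_def by blast
  qed
qed

text \<open>With \<open>w = L e\<close> and \<open>y = C e\<close>, the equation
  \<open>e' = Ac e\<close> becomes \<open>w' = M w\<close>, \<open>y' = A21 w + A22s y\<close>. A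
  large multiple of the form of \<open>P1\<close> in \<open>w\<close> dominates the coupling through
  \<open>A21\<close>. The inputs enter only the equation for \<open>y\<close>, where
  \<open>P\<close> acts as \<open>P2\<close>.\<close>

lemma canonical_form_lyapunov:
  fixes A J :: "real^'n^'n" and D :: "real^'q^'n" and C :: "real^'n^'p"
    and A22s P2 Q2 :: "real^'p^'p" and out :: "'p \<Rightarrow> 'n"
  defines "Ac \<equiv> A - linear_gain A J out A22s ** C" and "D2 \<equiv> out_rows out (J ** D)"
    and "Gn \<equiv> switching_gain D J out"
  assumes can: "canonical_form A D C J out" and Q2: "sym_pos_def Q2" and P2: "sym_pos_def P2"
    and lyap: "P2 ** A22s + transpose A22s ** P2 = - Q2"
  shows "\<exists>P \<epsilon>. sym_pos_def P \<and> 0 < \<epsilon> \<and>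
    (\<forall>e. e \<bullet> (P *v (Ac *v e)) \<le> - \<epsilon> * (norm e)\<^sup>2) \<and>
    (\<forall>e \<nu> x. e \<bullet> (P *v (Gn *v \<nu> - D *v x)) = (C *v e) \<bullet> (P2 *v (onorm ((*v) D2) *\<^sub>R \<nu> - D2 *v x)))"
proof -
  define Ji where "Ji = matrix_inv J"
  define Ab where "Ab = J ** A ** Ji"
  have inj: "inj out" and J: "J ** Ji = mat 1" "Ji ** J = mat 1"
    and CJ: "C ** Ji = (\<chi> i j. if j = out i then 1 else 0)"
    and JD: "\<And>i. i \<notin> range out \<Longrightarrow> (J ** D) $ i = 0"
    and ph: "principal_hurwitz (- range out) Ab"
    using can matrix_inv_right[of J] matrix_inv_left[of J]
    by (auto simp: canonical_form_def Ji_def Ab_def)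
  have C: "(C *v e) $ k = (J *v e) $ out k" for e k
  proof -
    have "C *v e = (C ** Ji) *v (J *v e)"
      by (simp add: matrix_vector_mul_assoc matrix_mul_assoc[symmetric] J)
    then show ?thesis by (simp add: CJ matrix_vector_mult_def if_distrib[of "\<lambda>x. x * _"] cong: if_cong)
  qed
  \<comment> \<open>\<open>L\<close> is \<open>J\<close> with the output rows set to zero: the block
    \<open>x_I\<close>, padded to the full index type.\<close>
  define L where "L = (\<chi> i j. if i = j \<and> i \<notin> range out then 1 else 0) ** J"
  have L: "(L *v e) $ i = (if i \<in> range out then 0 else (J *v e) $ i)" for e i
  proof -
    have "(L *v e) $ i = (\<Sum>j\<in>UNIV. (if i = j \<and> i \<notin> range out then 1 else 0) * (J *v e) $ j)"
      unfolding L_def matrix_vector_mul_assoc[symmetric]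
      by (subst matrix_vector_mult_def) simp
    also have "\<dots> = (\<Sum>j\<in>UNIV. if i = j then (if i \<in> range out then 0 else (J *v e) $ j) else 0)"
      by (rule sum.cong) auto
    finally have "(L *v e) $ i = \<dots>" .
    then show ?thesis by simp
  qed
  define M where "M = (\<chi> i j. if i \<in> - range out \<and> j \<in> - range out then Ab $ i $ j else if i = j then - 1 else 0)"
  have M: "(M *v w) $ i = (\<Sum>j\<in>UNIV. (if i \<in> - range out \<and> j \<in> - range out then Ab $ i $ j
      else if i = j then - 1 else 0) * w $ j)" for w i
    by (simp add: M_def matrix_vector_mult_def)
  define A21 where "A21 = out_rows out Ab"
  \<comment> \<open>The columns are separated into those outside and inside
    \<open>range out\<close>; on the latter the entries of \<open>J e\<close> are those of
    \<open>C e\<close>.\<close>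
  have split: "(Ab *v (J *v e)) $ i = (Ab *v (L *v e)) $ i + (out_cols out Ab *v (C *v e)) $ i" for e i
  proof -
    have "(Ab *v (J *v e)) $ i = (\<Sum>j\<in>UNIV. Ab $ i $ j * (J *v e) $ j)"
      by (simp add: matrix_vector_mult_def)
    also have "\<dots> = (\<Sum>j\<in>UNIV. Ab $ i $ j * (L *v e) $ j) + (\<Sum>j\<in>UNIV. if j \<in> range out then Ab $ i $ j * (J *v e) $ j else 0)"
      unfolding sum.distrib[symmetric] by (intro sum.cong) (auto simp: L)
    also have "(\<Sum>j\<in>UNIV. if j \<in> range out then Ab $ i $ j * (J *v e) $ j else 0)
        = (\<Sum>j\<in>range out. Ab $ i $ j * (J *v e) $ j)"
      by (simp add: sum.If_cases)
    also have "\<dots> = (\<Sum>k\<in>UNIV. Ab $ i $ out k * (J *v e) $ out k)"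
      using inj by (simp add: sum.reindex)
    finally have "(Ab *v (J *v e)) $ i = (\<Sum>j\<in>UNIV. Ab $ i $ j * (L *v e) $ j) + \<dots>" .
    moreover have "(out_cols out Ab *v y) $ i = (\<Sum>k\<in>UNIV. Ab $ i $ out k * y $ k)" for y
      by (simp add: matrix_vector_mult_def out_cols_def)
    ultimately show ?thesis
      by (simp add: matrix_vector_mult_def[of Ab "L *v e"] C)
  qed
  have JGl: "J *v (linear_gain A J out A22s *v y)
      = stack out (out_cols out Ab) (out_rows out (out_cols out Ab) - A22s) *v y" for y
    by (simp add: linear_gain_def Let_def matrix_vector_mul_assoc matrix_mul_assoc Ab_def Ji_def[symmetric] J)
  have JAc: "(J *v (Ac *v e)) $ i = (Ab *v (J *v e)) $ i
      - (stack out (out_cols out Ab) (out_rows out (out_cols out Ab) - A22s) *v (C *v e)) $ i" for e i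
  proof -
    have "J *v (Ac *v e) = J *v (A *v e) - J *v (linear_gain A J out A22s *v (C *v e))"
      by (simp add: Ac_def matrix_vector_mult_diff_rdistrib matrix_vector_mult_diff_distrib matrix_vector_mul_assoc)
    moreover have "J *v (A *v e) = Ab *v (J *v e)"
      by (simp add: Ab_def matrix_vector_mul_assoc matrix_mul_assoc[symmetric] J)
    ultimately show ?thesis by (simp add: JGl)
  qed
  \<comment> \<open>Outside the output rows the gain cancels the columns that multiply
    \<open>C e\<close>, so the block \<open>x_I\<close> of the error evolves on its own.\<close>
  have LAc: "L *v (Ac *v e) = M *v (L *v e)" for e
  proof -
    have "(L *v (Ac *v e)) $ i = (M *v (L *v e)) $ i" for i
    proof (cases "i \<in> range out")
      case True
      then have "(M *v (L *v e)) $ i = 0"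
        unfolding M by (intro sum.neutral) (auto simp: L)
      with True show ?thesis by (simp add: L)
    next
      case False
      have "(stack out (out_cols out Ab) Y *v y) $ i = (out_cols out Ab *v y) $ i" for Y y
        using False by (simp add: matrix_vector_mult_def stack_def)
      then have "(L *v (Ac *v e)) $ i = (Ab *v (L *v e)) $ i"
        using False by (simp add: L JAc split)
      also have "\<dots> = (M *v (L *v e)) $ i"
        unfolding M matrix_vector_mult_def[of Ab] vec_lambda_beta
        using False by (intro sum.cong) (auto simp: L)
      finally show ?thesis .
    qed
    then show ?thesis by (simp add: vec_eq_iff)
  qed
  \<comment> \<open>In the output rows the gain replaces the output block of \<open>Ab\<close> by
    \<open>A22s\<close>.\<close>
  have CAc: "C *v (Ac *v e) = A21 *v (L *v e) + A22s *v (C *v e)" for e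
  proof -
    have "(C *v (Ac *v e)) $ k = (A21 *v (L *v e) + A22s *v (C *v e)) $ k" for k
    proof -
      have "(stack out X Y *v y) $ out k = (Y *v y) $ k" for X and Y :: "real^'p^'p" and y
        using inj by (simp add: matrix_vector_mult_def stack_def)
      then have "(C *v (Ac *v e)) $ k = (Ab *v (L *v e)) $ out k + (out_cols out Ab *v (C *v e)) $ out k
          - ((out_rows out (out_cols out Ab) - A22s) *v (C *v e)) $ k"
        by (simp add: C[of "Ac *v e"] JAc split)
      then show ?thesis
        by (simp add: A21_def out_rows_def matrix_vector_mult_def[of "out_cols out Ab"] matrix_vector_mult_diff_rdistrib)
           (simp add: matrix_vector_mult_def)
    qed
    then show ?thesis by (simp add: vec_eq_iff)
  qed
  have "hurwitz M"
    using principal_hurwitz_completion[OF ph] by (simp add: M_def)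
  then obtain P1 where P1: "sym_pos_def P1" and P1M: "\<And>v. v \<bullet> (P1 *v (M *v v)) \<le> - (norm v)\<^sup>2 / 2"
    using hurwitz_lyapunov by blast
  obtain q where q: "q > 0" "\<And>y. q * (norm y)\<^sup>2 \<le> y \<bullet> (Q2 *v y)"
    using quadratic_form_coercive[of Q2] Q2 unfolding sym_pos_def_def by blast
  obtain c where c: "c > 0" "\<And>y w. \<bar>y \<bullet> ((P2 ** A21) *v w)\<bar> \<le> c * norm y * norm w"
    using quadratic_form_bounded by blast
  \<comment> \<open>The coupling costs \<open>c\<^sup>2 / q\<close> times
    \<open>(norm w)\<^sup>2\<close>, while \<open>P1\<close> supplies \<open>k / 2\<close>; this
    choice leaves \<open>1 / 2\<close>.\<close>
  define k where "k = 2 * c\<^sup>2 / q + 1"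
  have "k > 0" using q(1) by (simp add: k_def add_nonneg_pos)
  define P where "P = k *\<^sub>R (transpose L ** P1 ** L) + transpose C ** P2 ** C"
  have P: "e \<bullet> (P *v f) = k * ((L *v e) \<bullet> (P1 *v (L *v f))) + (C *v e) \<bullet> (P2 *v (C *v f))" for e f
    by (simp only: P_def matrix_vector_mult_add_rdistrib inner_add_right inner_transpose_left
        scaleR_matrix_vector_assoc[symmetric] matrix_vector_mul_assoc[symmetric] inner_scaleR_right)
  have symm: "v \<bullet> (S *v w) = w \<bullet> (S *v v)" if "sym_pos_def S" for S :: "real^'a^'a" and v w
    using that inner_transpose[of v S w] by (simp add: sym_pos_def_def inner_commute)
  have nz: "L *v e \<noteq> 0 \<or> C *v e \<noteq> 0" if "e \<noteq> 0" for e
  proof (rule ccontr)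
    assume "\<not> ?thesis"
    then have "(J *v e) $ i = 0" for i
      using L[of e i] C[of e] by (cases "i \<in> range out") auto
    then have "J *v e = 0" by (simp add: vec_eq_iff)
    then have "Ji *v (J *v e) = 0" by simp
    then show False using that by (simp add: matrix_vector_mul_assoc J)
  qed
  have nonneg: "v \<bullet> (S *v v) \<ge> 0" "v \<noteq> 0 \<Longrightarrow> v \<bullet> (S *v v) > 0"
    if "sym_pos_def S" for S :: "real^'a^'a" and v
    using that by (cases "v = 0"; force simp: sym_pos_def_def less_imp_le)+
  have "sym_pos_def P"
    unfolding sym_pos_def_def
  proof (intro conjI allI impI)
    show "transpose P = P"
    proof (rule transpose_eq_selfI)
      fix v w
      have "(P *v v) \<bullet> w = w \<bullet> (P *v v)" by (rule inner_commute)
      then show "v \<bullet> (P *v w) = (P *v v) \<bullet> w"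
        unfolding P using symm[OF P1, of "L *v w" "L *v v"] symm[OF P2, of "C *v w" "C *v v"] by simp
    qed
    show "e \<bullet> (P *v e) > 0" if "e \<noteq> 0" for e
      using nz[OF that] nonneg[OF P1, of "L *v e"] nonneg[OF P2, of "C *v e"] \<open>k > 0\<close>
      unfolding P by (auto intro: add_pos_nonneg add_nonneg_pos)
  qed
  moreover have neg: "e \<bullet> (P *v (Ac *v e)) \<le> - (1 / 2 * (norm (L *v e))\<^sup>2 + q / 4 * (norm (C *v e))\<^sup>2)" for e
  proof -
    define w y where "w = L *v e" and "y = C *v e"
    have "y \<bullet> ((P2 ** A22s + transpose A22s ** P2) *v y) = - (y \<bullet> (Q2 *v y))"
      unfolding lyap by (simp add: matrix_vector_mult_def inner_vec_def sum_negf)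
    moreover have "(A22s *v y) \<bullet> (P2 *v y) = y \<bullet> (P2 *v (A22s *v y))"
      by (rule symm[OF P2])
    ultimately have "2 * (y \<bullet> (P2 *v (A22s *v y))) = - (y \<bullet> (Q2 *v y))"
      by (simp only: matrix_vector_mult_add_rdistrib inner_add_right matrix_vector_mul_assoc[symmetric]
          inner_transpose_left mult_2)
    then have yy: "y \<bullet> (P2 *v (A22s *v y)) \<le> - q / 2 * (norm y)\<^sup>2"
      using q(2)[of y] by simp
    \<comment> \<open>Young's inequality, weighted so that the coupling takes only half of the decay
      \<open>q / 2\<close> in \<open>y\<close>.\<close>
    have "0 \<le> (2 * c * norm w - q * norm y)\<^sup>2" by simp
    then have "q * (c * norm y * norm w) * 4 \<le> q * q * (norm y)\<^sup>2 + 4 * (c\<^sup>2 * (norm w)\<^sup>2)"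
      by (simp add: power2_eq_square algebra_simps)
    moreover have "q * (q / 4 * (norm y)\<^sup>2 + c\<^sup>2 / q * (norm w)\<^sup>2)
        = (q * q * (norm y)\<^sup>2 + 4 * (c\<^sup>2 * (norm w)\<^sup>2)) / 4"
      using q(1) by (simp add: algebra_simps)
    ultimately have "q * (c * norm y * norm w) \<le> q * (q / 4 * (norm y)\<^sup>2 + c\<^sup>2 / q * (norm w)\<^sup>2)"
      by (simp only: pos_le_divide_eq[OF zero_less_numeral])
    then have "c * norm y * norm w \<le> q / 4 * (norm y)\<^sup>2 + c\<^sup>2 / q * (norm w)\<^sup>2"
      using q(1) by (simp only: mult_le_cancel_left_pos)
    then have yw: "y \<bullet> (P2 *v (A21 *v w)) \<le> q / 4 * (norm y)\<^sup>2 + c\<^sup>2 / q * (norm w)\<^sup>2"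
      using c(2)[of y w] by (simp add: matrix_vector_mul_assoc)
    have "k * (w \<bullet> (P1 *v (M *v w))) \<le> k * (- (norm w)\<^sup>2 / 2)"
      using P1M \<open>k > 0\<close> by (intro mult_left_mono) auto
    also have "\<dots> = - (c\<^sup>2 / q * (norm w)\<^sup>2) - (norm w)\<^sup>2 / 2"
      by (simp add: k_def algebra_simps)
    finally show ?thesis
      using yw yy unfolding P LAc CAc w_def[symmetric] y_def[symmetric]
      by (simp add: matrix_vector_right_distrib inner_add_right)
  qed
  \<comment> \<open>The bound in \<open>L e\<close> and \<open>C e\<close> becomes one in
    \<open>norm e\<close> by compactness of the unit sphere, as \<open>L\<close> and
    \<open>C\<close> have no common kernel.\<close>
  obtain \<epsilon> where \<epsilon>: "\<epsilon> > 0" "\<And>e. \<epsilon> * (norm e)\<^sup>2 \<le> e \<bullet> (- (P ** Ac) *v e)"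
  proof -
    have "e \<bullet> (- (P ** Ac) *v e) > 0" if "e \<noteq> 0" for e
    proof -
      have "1 / 2 * (norm (L *v e))\<^sup>2 + q / 4 * (norm (C *v e))\<^sup>2 > 0"
        using nz[OF that] q(1) by (auto intro: add_pos_nonneg add_nonneg_pos)
      moreover have "- (P ** Ac) *v e = - (P *v (Ac *v e))"
        by (simp add: matrix_vector_mul_assoc) (simp add: matrix_vector_mult_def vec_eq_iff sum_negf)
      ultimately show ?thesis using neg[of e] by simp
    qed
    then show thesis using that quadratic_form_coercive by blast
  qed
  have "e \<bullet> (P *v (Ac *v e)) \<le> - \<epsilon> * (norm e)\<^sup>2" for e
  proof -
    have "- (P ** Ac) *v e = - (P *v (Ac *v e))"
      by (simp add: matrix_vector_mul_assoc) (simp add: matrix_vector_mult_def vec_eq_iff sum_negf)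
    then show ?thesis using \<epsilon>(2)[of e] by simp
  qed
  moreover have "e \<bullet> (P *v (Gn *v \<nu> - D *v x)) = (C *v e) \<bullet> (P2 *v (onorm ((*v) D2) *\<^sub>R \<nu> - D2 *v x))" for e \<nu> x
  proof -
    have JGn: "J *v (Gn *v \<nu>) = onorm ((*v) D2) *\<^sub>R (stack out 0 (mat 1) *v \<nu>)"
      by (simp add: Gn_def switching_gain_def D2_def scaleR_matrix_vector_assoc[symmetric] matrix_vector_mult_scaleR
          matrix_vector_mul_assoc matrix_mul_assoc Ji_def[symmetric] J)
    have st: "(stack out 0 (mat 1) *v \<nu>) $ i = (if i \<in> range out then \<nu> $ inv out i else 0)" for i
    proof -
      have "(stack out 0 (mat 1) *v \<nu>) $ i = (if i \<in> range out then (mat 1 *v \<nu>) $ inv out i else 0)"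
        by (simp add: matrix_vector_mult_def stack_def)
      then show ?thesis by simp
    qed
    have JDx: "(J *v (D *v x)) $ i = (J ** D) $ i \<bullet> x" for i
      by (simp only: matrix_vector_mul_assoc matrix_vector_mul_component)
    \<comment> \<open>Matching: the injection and the uncertainty both act on the output block
      only.\<close>
    have "L *v (Gn *v \<nu> - D *v x) = 0"
      by (simp add: vec_eq_iff L matrix_vector_mult_diff_distrib JGn st JDx JD)
    moreover have "C *v (Gn *v \<nu> - D *v x) = onorm ((*v) D2) *\<^sub>R \<nu> - D2 *v x"
      using inj by (simp add: vec_eq_iff C matrix_vector_mult_diff_distrib JGn st JDx)
        (simp add: D2_def out_rows_def matrix_vector_mul_component)
    ultimately show ?thesis by (simp add: P)
  qed
  ultimately show ?thesis using \<epsilon>(1) by blast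
qed

section \<open>Absolutely continuous functions\<close>

text \<open>A countable cover for \<open>lborel\<close> also works for its completion. This makes
  Fubini available for the product of \<open>lebesgue\<close> with itself.\<close>

lemma sigma_finite_lebesgue: "sigma_finite_measure (lebesgue :: 'a::euclidean_space measure)"
proof
  obtain \<A> :: "'a set set" where \<A>: "countable \<A>" "\<A> \<subseteq> sets lborel" "\<Union>\<A> = space lborel"
    "\<forall>a\<in>\<A>. emeasure lborel a \<noteq> \<infinity>"
    using lborel.sigma_finite_countable by blast
  then show "\<exists>\<A> :: 'a set set. countable \<A> \<and> \<A> \<subseteq> sets lebesgue \<and> \<Union>\<A> = space lebesgue \<and>
      (\<forall>a\<in>\<A>. emeasure lebesgue a \<noteq> \<infinity>)"
    by (intro exI[of _ \<A>]) (auto simp: sets_completionI_sets)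
qed

text \<open>
  Fubini on the triangle \<open>s \<le> t\<close>; derivatives need not exist pointwise.
\<close>

lemma indefinite_integral_product:
  fixes f :: "real \<Rightarrow> 'a::euclidean_space" and g :: "real \<Rightarrow> 'b::euclidean_space"
    and prd :: "'a \<Rightarrow> 'b \<Rightarrow> 'c::euclidean_space"
  assumes bb: "bounded_bilinear prd"
    and f: "f absolutely_integrable_on {a..b}" and g: "g absolutely_integrable_on {a..b}"
  defines "F \<equiv> \<lambda>t. integral {a..t} f" and "G \<equiv> \<lambda>t. integral {a..t} g"
  shows "integral {a..b} (\<lambda>t. prd (F t) (g t)) + integral {a..b} (\<lambda>t. prd (f t) (G t))
         = prd (F b) (G b)"
    and "(\<lambda>t. prd (F t) (g t)) absolutely_integrable_on {a..b}"
    and "(\<lambda>t. prd (f t) (G t)) absolutely_integrable_on {a..b}"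
proof -
  interpret bb: bounded_bilinear prd by (rule bb)
  interpret L: sigma_finite_measure "lebesgue :: real measure"
    by (rule sigma_finite_lebesgue)
  interpret pair_sigma_finite "lebesgue :: real measure" "lebesgue :: real measure" ..
  have bl: "bilinear prd"
    using bb bilinear_conv_bounded_bilinear by blast
  have bl': "bilinear (\<lambda>y x. prd x y)"
    using bl by (simp add: bilinear_def)
  have cF: "continuous_on {a..b} F" and cG: "continuous_on {a..b} G"
    unfolding F_def G_def using f g
    by (blast intro: indefinite_integral_continuous_1 set_lebesgue_integral_eq_integral(1))+
  have bnd: "bounded (h ` {a..b})" if "continuous_on {a..b} h" for h :: "real \<Rightarrow> 'd::real_normed_vector"
    using that compact_continuous_image compact_imp_bounded by blast
  show aFg: "(\<lambda>t. prd (F t) (g t)) absolutely_integrable_on {a..b}"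
    by (rule absolutely_integrable_bounded_measurable_product[OF bl _ _ bnd[OF cF] g])
       (auto intro!: continuous_imp_measurable_on_sets_lebesgue cF)
  show afG: "(\<lambda>t. prd (f t) (G t)) absolutely_integrable_on {a..b}"
    by (rule absolutely_integrable_bounded_measurable_product[OF bl' _ _ bnd[OF cG] f])
       (auto intro!: continuous_imp_measurable_on_sets_lebesgue cG)
  \<comment> \<open>Extension by zero moves the integrals to the whole line.\<close>
  define f' where "f' = (\<lambda>s. indicator {a..b} s *\<^sub>R f s)"
  define g' where "g' = (\<lambda>s. indicator {a..b} s *\<^sub>R g s)"
  have f': "integrable lebesgue f'" and g': "integrable lebesgue g'"
    using f g by (auto simp: f'_def g'_def set_integrable_def)
  note [measurable] = borel_measurable_integrable[OF f'] borel_measurable_integrable[OF g']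
  have mb: "(\<lambda>(x, y). prd (u x) (v y)) \<in> borel_measurable (lebesgue \<Otimes>\<^sub>M lebesgue)"
    if [measurable]: "u \<in> borel_measurable lebesgue" "v \<in> borel_measurable lebesgue" for u v :: "real \<Rightarrow> _"
  proof -
    have "(\<lambda>p. (u (fst p), v (snd p))) \<in> borel_measurable (lebesgue \<Otimes>\<^sub>M lebesgue)"
      by measurable
    moreover have "continuous_on UNIV (\<lambda>q::'a \<times> 'b. prd (fst q) (snd q))"
      by (intro bb.continuous_on continuous_intros)
    ultimately show ?thesis
      using borel_measurable_continuous_on by (fastforce simp: case_prod_beta)
  qed
  define h where "h = (\<lambda>(s, t). indicator {s..} t *\<^sub>R prd (f' s) (g' t))"
  have indic [measurable]: "(\<lambda>(s, t). indicator {s..} t :: real) \<in> borel_measurable (lebesgue \<Otimes>\<^sub>M (lebesgue :: real measure))"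
  proof -
    have "(\<lambda>x::real. x) \<in> borel_measurable lebesgue"
      by (rule measurable_completion) simp
    note [measurable] = measurable_compose[OF measurable_fst this] measurable_compose[OF measurable_snd this]
    have "{p \<in> space (lebesgue \<Otimes>\<^sub>M lebesgue). fst p \<le> (snd p :: real)} \<in> sets (lebesgue \<Otimes>\<^sub>M lebesgue)"
      by measurable
    then show ?thesis
      by (subst measurable_cong[of _ _ "\<lambda>p. indicator {p. fst p \<le> snd p} p"])
         (auto simp: indicator_def space_pair_measure)
  qed
  have hm [measurable]: "h \<in> borel_measurable (lebesgue \<Otimes>\<^sub>M lebesgue)"
    using mb[of f' g'] indic unfolding h_def by (simp add: case_prod_beta)
  obtain K where K: "\<And>x y. norm (prd x y) \<le> norm x * norm y * K" and "K > 0"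
    using bb.pos_bounded by blast
  have prod_int: "integrable lebesgue (\<lambda>t. prd x (g' t))" for x
    by (rule integrable_bounded_linear[OF bb.bounded_linear_right g'])
  have inner_int: "integrable lebesgue (\<lambda>t. h (s, t))" for s
    unfolding h_def prod.case
    by (rule integrable_mult_indicator) (auto simp: prod_int)
  \<comment> \<open>Each section is integrable, and the integral of its norm is at most
    \<open>K\<close> times \<open>norm (f' x)\<close> times the total integral of
    \<open>norm (g' y)\<close>, which is integrable in \<open>x\<close>.\<close>
  have hint: "integrable (lebesgue \<Otimes>\<^sub>M lebesgue) (\<lambda>(x, y). h (x, y))"
  proof (rule Fubini_integrable)
    show "AE x in lebesgue. integrable lebesgue (\<lambda>y. case (x, y) of (x, y) \<Rightarrow> h (x, y))"
      using inner_int by auto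
    have "norm (LINT y|lebesgue. norm (h (x, y))) \<le> norm (norm (f' x) * (K * (LINT y|lebesgue. norm (g' y))))" for x
    proof -
      have "(LINT y|lebesgue. norm (h (x, y))) \<le> (LINT y|lebesgue. norm (f' x) * K * norm (g' y))"
      proof (rule integral_mono)
        show "norm (h (x, y)) \<le> norm (f' x) * K * norm (g' y)" for y
          using K[of "f' x" "g' y"] \<open>K > 0\<close> by (simp add: h_def indicator_def mult_ac)
      qed (use inner_int g' in auto)
      also have "\<dots> = norm (f' x) * (K * (LINT y|lebesgue. norm (g' y)))"
        by (simp add: mult.assoc)
      finally have "(LINT y|lebesgue. norm (h (x, y))) \<le> norm (f' x) * (K * (LINT y|lebesgue. norm (g' y)))" .
      moreover have "0 \<le> (LINT y|lebesgue. norm (h (x, y)))"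
        by (rule Bochner_Integration.integral_nonneg) simp
      ultimately show ?thesis unfolding real_norm_def by linarith
    qed
    then have le: "AE x in lebesgue. norm (LINT y|lebesgue. norm (h (x, y)))
        \<le> norm (norm (f' x) * (K * (LINT y|lebesgue. norm (g' y))))" by blast
    have "(\<lambda>(x, y). norm (h (x, y))) \<in> borel_measurable (lebesgue \<Otimes>\<^sub>M lebesgue)"
      using measurable_compose[OF hm borel_measurable_norm] by simp
    then have meas: "(\<lambda>x. LINT y|lebesgue. norm (h (x, y))) \<in> borel_measurable lebesgue"
      by (rule L.borel_measurable_lebesgue_integral)
    have "integrable lebesgue (\<lambda>x. norm (f' x) * (K * (LINT y|lebesgue. norm (g' y))))"
      using integrable_norm[OF f'] by (rule integrable_mult_left)
    from Bochner_Integration.integrable_bound[OF this meas le]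
    show "integrable lebesgue (\<lambda>x. LINT y|lebesgue. norm (case (x, y) of (x, y) \<Rightarrow> h (x, y)))"
      by simp
  qed simp
  \<comment> \<open>Integrating over the triangle first in \<open>t\<close> gives the increment
    \<open>G b - G s\<close>; first in \<open>s\<close>, as in \<open>F'\<close> below, it gives
    \<open>F t\<close>. Equating the two iterated integrals yields the product formula.\<close>
  have G': "(LINT t|lebesgue. h (s, t)) = indicator {a..b} s *\<^sub>R prd (f s) (G b - G s)" for s
  proof (cases "s \<in> {a..b}")
    case True
    have gi: "g absolutely_integrable_on {s..b}"
      using True by (intro absolutely_integrable_on_subinterval[OF g]) auto
    have "(LINT t|lebesgue. h (s, t)) = (LINT t|lebesgue. prd (f s) (indicator {s..b} t *\<^sub>R g t))"
      using True by (intro Bochner_Integration.integral_cong)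
        (auto simp: h_def f'_def g'_def indicator_def bb.zero_right)
    also have "\<dots> = prd (f s) (LINT t|lebesgue. indicator {s..b} t *\<^sub>R g t)"
      using gi by (intro integral_bounded_linear[OF bb.bounded_linear_right]) (simp add: set_integrable_def)
    also have "(LINT t|lebesgue. indicator {s..b} t *\<^sub>R g t) = integral {s..b} g"
      using set_lebesgue_integral_eq_integral(2)[OF gi] by (simp add: set_lebesgue_integral_def)
    also have "integral {s..b} g = G b - G s"
      using Henstock_Kurzweil_Integration.integral_combine[of a s b g] True g unfolding G_def
      by (simp add: set_lebesgue_integral_eq_integral(1) algebra_simps)
    finally show ?thesis using True by simp
  qed (auto simp: h_def f'_def bb.zero_left)
  have F': "(LINT s|lebesgue. h (s, t)) = indicator {a..b} t *\<^sub>R prd (F t) (g t)" for t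
  proof (cases "t \<in> {a..b}")
    case True
    have fi: "f absolutely_integrable_on {a..t}"
      using True by (intro absolutely_integrable_on_subinterval[OF f]) auto
    have "(LINT s|lebesgue. h (s, t)) = (LINT s|lebesgue. prd (indicator {a..t} s *\<^sub>R f s) (g t))"
      using True by (intro Bochner_Integration.integral_cong)
        (auto simp: h_def f'_def g'_def indicator_def bb.zero_left)
    also have "\<dots> = prd (LINT s|lebesgue. indicator {a..t} s *\<^sub>R f s) (g t)"
      using fi by (intro integral_bounded_linear[OF bb.bounded_linear_left]) (simp add: set_integrable_def)
    also have "(LINT s|lebesgue. indicator {a..t} s *\<^sub>R f s) = F t"
      using set_lebesgue_integral_eq_integral(2)[OF fi] by (simp add: set_lebesgue_integral_def F_def)
    finally show ?thesis using True by simp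
  qed (auto simp: h_def g'_def bb.zero_right)
  have "integral {a..b} (\<lambda>t. prd (F t) (g t)) = (LINT t|lebesgue. indicator {a..b} t *\<^sub>R prd (F t) (g t))"
    using set_lebesgue_integral_eq_integral(2)[OF aFg] by (simp add: set_lebesgue_integral_def)
  also have "\<dots> = (LINT s|lebesgue. indicator {a..b} s *\<^sub>R prd (f s) (G b - G s))"
    using Fubini_integral[OF hint] by (simp add: F' G')
  also have "\<dots> = integral {a..b} (\<lambda>s. prd (f s) (G b - G s))"
  proof -
    have "(\<lambda>s. prd (f s) (G b - G s)) absolutely_integrable_on {a..b}"
      using set_integral_diff(1)[OF absolutely_integrable_linear[OF f bb.bounded_linear_left[of "G b"]] afG]
      by (simp add: bb.diff_right o_def)
    from set_lebesgue_integral_eq_integral(2)[OF this] show ?thesis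
      by (simp add: set_lebesgue_integral_def)
  qed
  also have "\<dots> = integral {a..b} (\<lambda>s. prd (f s) (G b)) - integral {a..b} (\<lambda>s. prd (f s) (G s))"
    unfolding bb.diff_right using afG absolutely_integrable_linear[OF f bb.bounded_linear_left[of "G b"]]
    by (intro Henstock_Kurzweil_Integration.integral_diff)
       (auto simp: o_def set_lebesgue_integral_eq_integral(1))
  also have "integral {a..b} (\<lambda>s. prd (f s) (G b)) = prd (F b) (G b)"
    using integral_linear[OF _ bb.bounded_linear_left[of "G b"], of f "{a..b}"] f
    by (simp add: o_def F_def set_lebesgue_integral_eq_integral(1))
  finally show "integral {a..b} (\<lambda>t. prd (F t) (g t)) + integral {a..b} (\<lambda>t. prd (f t) (G t))
         = prd (F b) (G b)" by simp
qed

section \<open>Calculus of absolutely continuous functions\<close>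

text \<open>\<open>caratheodory\<close> for values in any Euclidean space: the same calculus is
  needed for real Lyapunov functions and for the matrix \<open>R\<close>.\<close>

definition abs_cont_deriv :: "(real \<Rightarrow> 'a::euclidean_space) \<Rightarrow> (real \<Rightarrow> 'a) \<Rightarrow> bool"
  where "abs_cont_deriv z g \<longleftrightarrow>
    (\<forall>t\<ge>0. g absolutely_integrable_on {0..t} \<and> z t = z 0 + integral {0..t} g)"

lemma caratheodory_iff: "caratheodory z g \<longleftrightarrow> abs_cont_deriv z g"
  by (simp add: caratheodory_def abs_cont_deriv_def)

lemma abs_cont_deriv_eq:
  "abs_cont_deriv z g \<Longrightarrow> 0 \<le> t \<Longrightarrow> z t = z 0 + integral {0..t} g"
  unfolding abs_cont_deriv_def by blast

lemma abs_cont_deriv_integrable: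
  assumes "abs_cont_deriv z g" "0 \<le> s"
  shows "g absolutely_integrable_on {s..t}"
proof (cases "s \<le> t")
  case True
  have "g absolutely_integrable_on {0..t}" using assms True by (auto simp: abs_cont_deriv_def)
  then show ?thesis by (rule absolutely_integrable_on_subinterval) (use assms in auto)
qed (simp add: absolutely_integrable_on_def)

lemma abs_cont_deriv_diff_eq:
  assumes "abs_cont_deriv z g" "0 \<le> s" "s \<le> t"
  shows "z t - z s = integral {s..t} g"
proof -
  have "g integrable_on {0..t}"
    using abs_cont_deriv_integrable[OF assms(1), of 0] set_lebesgue_integral_eq_integral(1) by blast
  then have "integral {0..s} g + integral {s..t} g = integral {0..t} g"
    using assms by (intro Henstock_Kurzweil_Integration.integral_combine) auto
  moreover have "z t = z 0 + integral {0..t} g" "z s = z 0 + integral {0..s} g"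
    using assms by (blast intro: abs_cont_deriv_eq order_trans)+
  ultimately show ?thesis by (simp add: algebra_simps)
qed

lemma abs_cont_deriv_continuous:
  assumes "abs_cont_deriv z g"
  shows "continuous_on {0..} z"
proof -
  have c: "continuous_on {0..b} z" if "0 \<le> b" for b
  proof -
    have "continuous_on {0..b} (\<lambda>t. z 0 + integral {0..t} g)"
      using abs_cont_deriv_integrable[OF assms, of 0 b] set_lebesgue_integral_eq_integral(1)
      by (intro continuous_on_add continuous_on_const indefinite_integral_continuous_1) blast+
    moreover have "continuous_on {0..b} z = continuous_on {0..b} (\<lambda>t. z 0 + integral {0..t} g)"
      by (rule continuous_on_cong[OF refl]) (rule abs_cont_deriv_eq[OF assms], simp)
    ultimately show ?thesis by simp
  qed
  show ?thesis
    unfolding continuous_on_eq_continuous_within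
  proof
    fix x :: real assume "x \<in> {0..}"
    then have "continuous (at x within {0..x + 1}) z"
      using c[of "x + 1"] by (auto simp: continuous_on_eq_continuous_within)
    moreover have "at x within {0..x + 1} = at x within {0..}"
      by (rule at_within_nhd[of _ "{..<x + 1}"]) auto
    ultimately show "continuous (at x within {0..}) z" by simp
  qed
qed

lemma abs_cont_deriv_cong:
  assumes "abs_cont_deriv z g" "\<And>t. 0 \<le> t \<Longrightarrow> z t = z' t" "\<And>t. 0 \<le> t \<Longrightarrow> g t = g' t"
  shows "abs_cont_deriv z' g'"
  unfolding abs_cont_deriv_def
proof (intro allI impI)
  fix t :: real assume t: "0 \<le> t"
  have "g absolutely_integrable_on {0..t} \<longleftrightarrow> g' absolutely_integrable_on {0..t}"
    unfolding absolutely_integrable_on_def using assms(3)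
    by (intro conj_cong integrable_cong) auto
  moreover have "integral {0..t} g = integral {0..t} g'"
    using assms(3) by (intro Henstock_Kurzweil_Integration.integral_cong) auto
  ultimately show "g' absolutely_integrable_on {0..t} \<and> z' t = z' 0 + integral {0..t} g'"
    using abs_cont_deriv_integrable[OF assms(1), of 0 t] abs_cont_deriv_eq[OF assms(1) t] assms(2) t
    by simp
qed

lemma abs_cont_deriv_C1:
  assumes "\<And>t. 0 \<le> t \<Longrightarrow> (z has_vector_derivative g t) (at t within {0..})" "continuous_on {0..} g"
  shows "abs_cont_deriv z g"
  unfolding abs_cont_deriv_def
proof (intro allI impI conjI)
  fix t :: real assume t: "0 \<le> t"
  show "g absolutely_integrable_on {0..t}"
    by (rule absolutely_integrable_continuous_real) (rule continuous_on_subset[OF assms(2)], simp)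
  have "(g has_integral (z t - z 0)) {0..t}"
    using t by (intro fundamental_theorem_of_calculus)
      (auto intro!: has_vector_derivative_within_subset[OF assms(1)])
  then show "z t = z 0 + integral {0..t} g" by (simp add: integral_unique)
qed

lemma abs_cont_deriv_const: "abs_cont_deriv (\<lambda>_. c) (\<lambda>_. 0)"
  by (simp add: abs_cont_deriv_def)

lemma abs_cont_deriv_linear:
  assumes "abs_cont_deriv z g" "bounded_linear L"
  shows "abs_cont_deriv (\<lambda>t. L (z t)) (\<lambda>t. L (g t))"
  unfolding abs_cont_deriv_def
proof (intro allI impI conjI)
  fix t :: real assume t: "0 \<le> t"
  have gi: "g absolutely_integrable_on {0..t}" and z: "z t = z 0 + integral {0..t} g"
    using assms(1) t abs_cont_deriv_integrable abs_cont_deriv_eq by blast+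
  show "(\<lambda>t. L (g t)) absolutely_integrable_on {0..t}"
    using absolutely_integrable_linear[OF gi assms(2)] by (simp add: o_def)
  show "L (z t) = L (z 0) + integral {0..t} (\<lambda>t. L (g t))"
    using integral_linear[OF _ assms(2), of g "{0..t}"] gi z
    by (simp add: o_def linear_add[OF bounded_linear.linear[OF assms(2)]] set_lebesgue_integral_eq_integral(1))
qed

lemma abs_cont_deriv_add:
  assumes "abs_cont_deriv z g" "abs_cont_deriv w h"
  shows "abs_cont_deriv (\<lambda>t. z t + w t) (\<lambda>t. g t + h t)"
  unfolding abs_cont_deriv_def
proof (intro allI impI)
  fix t :: real assume t: "0 \<le> t"
  have gh: "g absolutely_integrable_on {0..t}" "h absolutely_integrable_on {0..t}"
    using assms abs_cont_deriv_integrable by blast+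
  then show "(\<lambda>t. g t + h t) absolutely_integrable_on {0..t} \<and>
      z t + w t = z 0 + w 0 + integral {0..t} (\<lambda>t. g t + h t)"
    using abs_cont_deriv_eq[OF assms(1) t] abs_cont_deriv_eq[OF assms(2) t]
    by (simp add: Henstock_Kurzweil_Integration.integral_add set_lebesgue_integral_eq_integral(1)
        set_integral_add(1))
qed

lemma abs_cont_deriv_diff:
  assumes "abs_cont_deriv z g" "abs_cont_deriv w h"
  shows "abs_cont_deriv (\<lambda>t. z t - w t) (\<lambda>t. g t - h t)"
  using abs_cont_deriv_add[OF assms(1) abs_cont_deriv_linear[OF assms(2) bounded_linear_minus[OF bounded_linear_ident]]]
  by simp

lemma abs_cont_deriv_sum:
  assumes "\<And>i. i \<in> I \<Longrightarrow> abs_cont_deriv (z i) (g i)"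
  shows "abs_cont_deriv (\<lambda>t. \<Sum>i\<in>I. z i t) (\<lambda>t. \<Sum>i\<in>I. g i t)"
  using assms by (induction I rule: infinite_finite_induct) (auto intro: abs_cont_deriv_add abs_cont_deriv_const)

text \<open>The product rule for every product that occurs: scalar, inner, matrix with vector,
  matrix with matrix. Splitting off the initial values leaves terms that are linear in
  \<open>z\<close> or \<open>w\<close> and one product of indefinite integrals.\<close>

lemma abs_cont_deriv_bilinear:
  fixes prd :: "'a::euclidean_space \<Rightarrow> 'b::euclidean_space \<Rightarrow> 'c::euclidean_space"
  assumes bb: "bounded_bilinear prd" and z: "abs_cont_deriv z g" and w: "abs_cont_deriv w h"
  shows "abs_cont_deriv (\<lambda>t. prd (z t) (w t)) (\<lambda>t. prd (z t) (h t) + prd (g t) (w t))"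
proof -
  interpret bb: bounded_bilinear prd by (rule bb)
  have main: "abs_cont_deriv (\<lambda>t. prd (integral {0..t} g) (integral {0..t} h))
      (\<lambda>t. prd (integral {0..t} g) (h t) + prd (g t) (integral {0..t} h))"
    unfolding abs_cont_deriv_def
  proof (intro allI impI)
    fix t :: real assume "0 \<le> t"
    then have gh: "g absolutely_integrable_on {0..t}" "h absolutely_integrable_on {0..t}"
      using z w abs_cont_deriv_integrable by blast+
    note p = indefinite_integral_product[OF bb gh]
    show "(\<lambda>t. prd (integral {0..t} g) (h t) + prd (g t) (integral {0..t} h)) absolutely_integrable_on {0..t} \<and>
      prd (integral {0..t} g) (integral {0..t} h) = prd (integral {0..0} g) (integral {0..0} h) +
      integral {0..t} (\<lambda>t. prd (integral {0..t} g) (h t) + prd (g t) (integral {0..t} h))"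
      using p by (simp add: set_integral_add(1) bb.zero_left
          Henstock_Kurzweil_Integration.integral_add set_lebesgue_integral_eq_integral(1))
  qed
  \<comment> \<open>With \<open>F\<close> and \<open>G\<close> the integrals of \<open>g\<close> and
    \<open>h\<close>, this is \<open>z w = z(0) w + z w(0) + F G - z(0) w(0)\<close>.\<close>
  have "abs_cont_deriv (\<lambda>t. prd (z 0) (w t) + (prd (z t) (w 0) + (prd (integral {0..t} g) (integral {0..t} h) - prd (z 0) (w 0))))
     (\<lambda>t. prd (z 0) (h t) + (prd (g t) (w 0) + (prd (integral {0..t} g) (h t) + prd (g t) (integral {0..t} h) - 0)))"
    by (intro abs_cont_deriv_add abs_cont_deriv_diff abs_cont_deriv_const main
        abs_cont_deriv_linear[OF w bb.bounded_linear_right] abs_cont_deriv_linear[OF z bb.bounded_linear_left])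
  then show ?thesis
  proof (rule abs_cont_deriv_cong)
    fix t :: real assume "0 \<le> t"
    then have *: "z t = z 0 + integral {0..t} g" "w t = w 0 + integral {0..t} h"
      using z w abs_cont_deriv_eq by blast+
    show "prd (z 0) (w t) + (prd (z t) (w 0) + (prd (integral {0..t} g) (integral {0..t} h) - prd (z 0) (w 0))) = prd (z t) (w t)"
      by (subst (1 2) *(1), subst (1 2) *(2)) (simp add: bb.add_left bb.add_right)
    show "prd (z 0) (h t) + (prd (g t) (w 0) + (prd (integral {0..t} g) (h t) + prd (g t) (integral {0..t} h) - 0)) =
         prd (z t) (h t) + prd (g t) (w t)"
      by (subst *(1), subst *(2)) (simp add: bb.add_left bb.add_right)
  qed
qed

section \<open>Differential inequalities\<close>

text \<open>On the null set where the inequality may fail, \<open>f\<close> is replaced by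
  \<open>g\<close>; this leaves its integral unchanged and makes the inequality hold everywhere on
  the interval.\<close>

lemma abs_cont_deriv_increase_le:
  fixes F f g :: "real \<Rightarrow> real"
  assumes F: "abs_cont_deriv F f" and st: "0 \<le> s" "s \<le> t"
    and le: "AE \<tau> in lebesgue. s \<le> \<tau> \<longrightarrow> \<tau> \<le> t \<longrightarrow> f \<tau> \<le> g \<tau>" and g: "g integrable_on {s..t}"
  shows "F t - F s \<le> integral {s..t} g"
proof -
  obtain N where N: "{\<tau>. \<not> (s \<le> \<tau> \<longrightarrow> \<tau> \<le> t \<longrightarrow> f \<tau> \<le> g \<tau>)} \<subseteq> N" "N \<in> null_sets lebesgue"
    using le by (auto simp: eventually_ae_filter)
  then have neg: "negligible N" by (simp add: negligible_iff_null_sets)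
  define f' where "f' = (\<lambda>\<tau>. if \<tau> \<in> N then g \<tau> else f \<tau>)"
  have fi: "f integrable_on {s..t}"
    using abs_cont_deriv_integrable[OF F st(1)] set_lebesgue_integral_eq_integral(1) by blast
  have "integral {s..t} f = integral {s..t} f'"
    by (rule integral_spike[OF neg]) (auto simp: f'_def)
  moreover have "f' integrable_on {s..t}"
    by (rule integrable_spike[OF fi neg]) (auto simp: f'_def)
  then have "integral {s..t} f' \<le> integral {s..t} g"
    by (rule integral_le[OF _ g]) (use N in \<open>auto simp: f'_def\<close>)
  ultimately show ?thesis using abs_cont_deriv_diff_eq[OF F st] by simp
qed

lemma abs_cont_deriv_exp: "abs_cont_deriv (\<lambda>t. exp (k * t)) (\<lambda>t. k * exp (k * t))" for k :: real
  by (rule abs_cont_deriv_C1)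
     (auto intro!: derivative_eq_intros continuous_intros simp flip: has_real_derivative_iff_has_vector_derivative)

text \<open>Gronwall's lemma: \<open>exp (k * t) * V t\<close> does not increase. The sign of
  \<open>k\<close> is free, and a negative \<open>k\<close> gives a growth bound.\<close>

lemma abs_cont_deriv_decay:
  fixes V v :: "real \<Rightarrow> real"
  assumes V: "abs_cont_deriv V v" and st: "0 \<le> s" "s \<le> t"
    and le: "AE \<tau> in lebesgue. s \<le> \<tau> \<longrightarrow> \<tau> \<le> t \<longrightarrow> v \<tau> \<le> - k * V \<tau>"
  shows "V t \<le> exp (- k * (t - s)) * V s"
proof -
  have "abs_cont_deriv (\<lambda>t. exp (k * t) * V t) (\<lambda>t. exp (k * t) * v t + (k * exp (k * t)) * V t)"
    by (rule abs_cont_deriv_bilinear[OF bounded_bilinear_mult abs_cont_deriv_exp V])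
  then have "exp (k * t) * V t - exp (k * s) * V s \<le> integral {s..t} (\<lambda>_. 0)"
  proof (rule abs_cont_deriv_increase_le[OF _ st])
    show "AE \<tau> in lebesgue. s \<le> \<tau> \<longrightarrow> \<tau> \<le> t \<longrightarrow> exp (k * \<tau>) * v \<tau> + k * exp (k * \<tau>) * V \<tau> \<le> 0"
      using le
    proof eventually_elim
      case (elim \<tau>)
      show ?case
      proof (intro impI)
        assume "s \<le> \<tau>" "\<tau> \<le> t"
        then have "exp (k * \<tau>) * v \<tau> \<le> exp (k * \<tau>) * (- k * V \<tau>)"
          using elim by (intro mult_left_mono) auto
        then show "exp (k * \<tau>) * v \<tau> + k * exp (k * \<tau>) * V \<tau> \<le> 0"
          by (simp add: algebra_simps)
      qed
    qed
  qed auto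
  then have "exp (- k * t) * (exp (k * t) * V t) \<le> exp (- k * t) * (exp (k * s) * V s)"
    by simp
  moreover have "exp (- k * t) * (exp (k * t) * V t) = V t"
    by (simp add: mult.assoc[symmetric] exp_minus)
  moreover have "exp (- k * t) * exp (k * s) = exp (- k * (t - s))"
    unfolding exp_add[symmetric] by (simp add: algebra_simps)
  ultimately show ?thesis by (metis mult.assoc)
qed

section \<open>The switching term and the least squares gain\<close>

lemma sym_pos_def_commute: "sym_pos_def S \<Longrightarrow> v \<bullet> (S *v w) = w \<bullet> (S *v v)"
  using inner_transpose[of v S w] by (simp add: sym_pos_def_def inner_commute)

text \<open>A closed ball is closed and convex, so it contains the closed convex hull; the removed
  null set is taken to be empty.\<close>

lemma filippov_subset_cball:
  assumes "x \<in> filippov f w" "0 < \<delta>" "f ` ball w \<delta> \<subseteq> cball a r"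
  shows "x \<in> cball a r"
proof -
  have "x \<in> closure (convex hull (f ` (ball w \<delta> - {})))"
    using assms(1,2) unfolding filippov_def by blast
  moreover have "closure (convex hull (f ` (ball w \<delta> - {}))) \<subseteq> cball a r"
    using assms(3) by (intro closure_minimal hull_minimal) auto
  ultimately show ?thesis by blast
qed

text \<open>By continuity small balls are mapped into arbitrarily small closed balls around
  \<open>f w\<close>, and these contain the Filippov set.\<close>

lemma filippov_isCont:
  assumes "x \<in> filippov f w" "isCont f w"
  shows "x = f w"
proof -
  have "dist (f w) x \<le> e" if "e > 0" for e
  proof -
    obtain \<delta> where "\<delta> > 0" "\<And>y. dist y w < \<delta> \<Longrightarrow> dist (f y) (f w) < e"
      using assms(2) \<open>e > 0\<close> unfolding continuous_at_eps_delta by blast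
    then have "f ` ball w \<delta> \<subseteq> cball (f w) e"
      by (auto simp: dist_commute less_imp_le)
    from filippov_subset_cball[OF assms(1) \<open>\<delta> > 0\<close> this] show ?thesis by simp
  qed
  then show ?thesis by (metis dist_eq_0_iff dist_pos_lt dual_order.irrefl field_lbound_gt_zero not_less zero_less_dist_iff)
qed

lemma norm_injection_le: "0 \<le> \<rho> \<Longrightarrow> norm (injection P2 \<rho> w) \<le> \<rho>"
  by (simp add: injection_def)

lemma norm_filippov_injection_le:
  assumes "\<nu> \<in> filippov (injection P2 \<rho>) w" "0 \<le> \<rho>"
  shows "norm \<nu> \<le> \<rho>"
proof -
  have "injection P2 \<rho> ` ball w 1 \<subseteq> cball 0 \<rho>"
    using norm_injection_le[OF assms(2)] by auto
  from filippov_subset_cball[OF assms(1) zero_less_one this] show ?thesis by simp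
qed

lemma isCont_injection:
  assumes "sym_pos_def P2" "w \<noteq> 0"
  shows "isCont (injection P2 \<rho>) w"
proof -
  have nz: "P2 *v w \<noteq> 0"
    using assms unfolding sym_pos_def_def by (metis inner_zero_right less_irrefl)
  have lin: "isCont ((*v) P2) w"
    by (simp add: linear_continuous_at)
  have "isCont (\<lambda>w. (- \<rho> / norm (P2 *v w)) *\<^sub>R (P2 *v w)) w"
    using nz by (intro continuous_intros lin) auto
  moreover have "\<forall>\<^sub>F v in nhds w. injection P2 \<rho> v = (- \<rho> / norm (P2 *v v)) *\<^sub>R (P2 *v v)"
    using t1_space_nhds[of w 0] assms(2) by (auto simp: injection_def elim: eventually_mono)
  ultimately show ?thesis by (simp add: isCont_cong)
qed

text \<open>For nonzero \<open>y\<close> the injection is continuous, so \<open>\<nu>\<close> points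
  against \<open>P2 y\<close> with length \<open>\<rho>\<close>; scaled by the operator norm of
  \<open>D2\<close> it dominates \<open>D2 x\<close> by Cauchy-Schwarz. On the sliding surface
  \<open>y = 0\<close> the left side vanishes for every selection.\<close>

lemma filippov_injection_dissipative:
  fixes D2 :: "real^'q^'p"
  assumes "sym_pos_def P2" "\<nu> \<in> filippov (injection P2 \<rho>) y" "norm x \<le> \<rho>"
  shows "y \<bullet> (P2 *v (onorm ((*v) D2) *\<^sub>R \<nu> - D2 *v x)) \<le> 0"
proof (cases "y = 0")
  case False
  define w c where "w = P2 *v y" and "c = onorm ((*v) D2)"
  have "c \<ge> 0" unfolding c_def by (rule onorm_pos_le) simp
  have "w \<noteq> 0"
    using assms(1) False unfolding sym_pos_def_def w_def by (metis inner_zero_right less_irrefl)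
  have "\<nu> = injection P2 \<rho> y"
    by (rule filippov_isCont[OF assms(2) isCont_injection[OF assms(1) False]])
  then have "w \<bullet> \<nu> = - \<rho> * norm w"
    using False \<open>w \<noteq> 0\<close> by (simp add: injection_def w_def[symmetric] power2_norm_eq_inner[symmetric] power2_eq_square)
  then have "w \<bullet> (c *\<^sub>R \<nu>) = - (c * \<rho> * norm w)" by simp
  moreover have "- (w \<bullet> (D2 *v x)) \<le> c * \<rho> * norm w"
  proof -
    have "- (w \<bullet> (D2 *v x)) \<le> norm w * norm (D2 *v x)"
      using Cauchy_Schwarz_ineq2[of w "D2 *v x"] by linarith
    also have "\<dots> \<le> norm w * (c * norm x)"
      unfolding c_def by (intro mult_left_mono onorm) auto
    also have "\<dots> \<le> norm w * (c * \<rho>)"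
      using assms(3) \<open>c \<ge> 0\<close> by (intro mult_left_mono) auto
    finally show ?thesis by (simp add: mult_ac)
  qed
  ultimately have "w \<bullet> (c *\<^sub>R \<nu> - D2 *v x) \<le> 0" by (simp add: inner_diff_right)
  then show ?thesis
    unfolding sym_pos_def_commute[OF assms(1), of y] w_def c_def by (simp add: inner_commute)
qed simp

section \<open>Matrix products and the bound on the least squares gain\<close>

lemma bounded_bilinear_matrix_vector_mult:
  "bounded_bilinear (\<lambda>(A::real^'n^'m) x. A *v x)"
  unfolding bilinear_conv_bounded_bilinear[symmetric] bilinear_def
  by (auto intro!: linearI simp: matrix_vector_mult_add_rdistrib matrix_vector_right_distrib
      scaleR_matrix_vector_assoc[symmetric] matrix_vector_mult_scaleR)

lemma bounded_bilinear_matrix_matrix_mult: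
  "bounded_bilinear (\<lambda>(A::real^'n^'m) (B::real^'k^'n). A ** B)"
  unfolding bilinear_conv_bounded_bilinear[symmetric] bilinear_def
  by (auto intro!: linearI simp: vec_eq_iff
      matrix_matrix_mult_def sum_distrib_left algebra_simps sum.distrib)

lemma bounded_bilinear_quadratic_form:
  "bounded_bilinear (\<lambda>x y. x \<bullet> ((P::real^'n^'m) *v y))"
  unfolding bilinear_conv_bounded_bilinear[symmetric] bilinear_def
  by (auto intro!: linearI simp: matrix_vector_right_distrib inner_add_left inner_add_right
      matrix_vector_mult_scaleR)

text \<open>\<open>norm\<close> on matrices is the Frobenius norm, whereas the gain estimate bounds
  the action on vectors. The conversion constant is crude, since only boundedness matters.\<close>

lemma norm_matrix_le_of_bound:
  fixes X :: "real^'n^'m" and c :: real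
  assumes "\<And>v. norm (X *v v) \<le> c * norm v"
  shows "norm X \<le> CARD('m) * (CARD('n) * c)"
proof -
  have "\<bar>X $ i $ j\<bar> \<le> c" for i j
    using assms[of "axis j 1"] component_le_norm_cart[of "X *v axis j 1" i]
    by (simp add: matrix_vector_mul_component inner_axis)
  then have "norm (X $ i) \<le> CARD('n) * c" for i
    using norm_le_l1_cart[of "X $ i"] sum_bounded_above[of UNIV "\<lambda>j. \<bar>X $ i $ j\<bar>" c]
    by (auto intro: order_trans)
  moreover have "norm X \<le> (\<Sum>i\<in>UNIV. norm (X $ i))"
    unfolding norm_vec_def by (rule L2_set_le_sum) simp
  ultimately show ?thesis
    using sum_bounded_above[of UNIV "\<lambda>i. norm (X $ i)" "CARD('n) * c"] by (auto intro: order_trans)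
qed

text \<open>The inverse \<open>M\<close> of \<open>R\<close> satisfies \<open>M' = K\<close>, hence
  grows from \<open>I / \<mu>\<close> in the order of quadratic forms. Its lower bound is an upper
  bound for \<open>R\<close>.\<close>

lemma riccati_gain_bound:
  fixes R K :: "real \<Rightarrow> real^'k^'k"
  assumes R: "\<And>t. 0 \<le> t \<Longrightarrow> (R has_vector_derivative - (R t ** K t ** R t)) (at t within {0..})"
    and K: "continuous_on {0..} K" and psd: "\<And>t v. 0 \<le> t \<Longrightarrow> 0 \<le> v \<bullet> (K t *v v)"
    and R0: "R 0 = \<mu> *\<^sub>R mat 1" and "\<mu> > 0" and "0 \<le> T"
  shows "norm (R T *v v) \<le> \<mu> * norm v"
proof -
  note mm = bounded_bilinear_matrix_matrix_mult and mv = bounded_bilinear_matrix_vector_mult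
  have Rc: "continuous_on {0..} R"
    unfolding continuous_on_eq_continuous_within
    using R by (auto intro: has_vector_derivative_continuous)
  have RK: "continuous_on {0..} (\<lambda>t. R t ** K t)"
    by (rule bounded_bilinear.continuous_on[OF mm Rc K])
  have "continuous_on {0..} (\<lambda>t. - (R t ** K t ** R t))"
    by (rule continuous_on_minus[OF bounded_bilinear.continuous_on[OF mm RK Rc]])
  with R have acR: "abs_cont_deriv R (\<lambda>t. - (R t ** K t ** R t))"
    by (rule abs_cont_deriv_C1)
  \<comment> \<open>\<open>M\<close> is the inverse of \<open>R\<close>, because \<open>W = R M - I\<close> solves a linear equation with \<open>W 0 = 0\<close>\<close>
  define M where "M t = (1 / \<mu>) *\<^sub>R mat 1 + integral {0..t} K" for t
  have acM: "abs_cont_deriv M K"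
    unfolding abs_cont_deriv_def
    by (auto simp: M_def intro!: absolutely_integrable_continuous_real continuous_on_subset[OF K])
  define W where "W t = R t ** M t - mat 1" for t
  have acW: "abs_cont_deriv W (\<lambda>t. - ((R t ** K t) ** W t))"
    using abs_cont_deriv_diff[OF abs_cont_deriv_bilinear[OF mm acR acM] abs_cont_deriv_const[of "mat 1"]]
  proof (rule abs_cont_deriv_cong)
    fix t
    have "R t ** K t ** W t = R t ** K t ** R t ** M t - R t ** K t"
      unfolding W_def by (simp add: bounded_bilinear.diff_right[OF mm] matrix_mul_assoc)
    then show "R t ** K t + - (R t ** K t ** R t) ** M t - 0 = - (R t ** K t ** W t)"
      by (simp add: bounded_bilinear.minus_left[OF mm])
  qed (simp add: W_def)
  \<comment> \<open>\<open>T\<close> is fixed, so a bound on a compact interval suffices for the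
    uniqueness argument.\<close>
  have "compact ((\<lambda>t. R t ** K t) ` {0..T})"
    by (rule compact_continuous_image[OF continuous_on_subset[OF RK]]) auto
  then obtain L where L: "\<And>t. 0 \<le> t \<Longrightarrow> t \<le> T \<Longrightarrow> norm (R t ** K t) \<le> L"
    using compact_imp_bounded bounded_iff by (metis (no_types, lifting) atLeastAtMost_iff imageI)
  obtain c where c: "c > 0" "\<And>(X::real^'k^'k) x. norm (X *v x) \<le> norm X * norm x * c"
    using bounded_bilinear.pos_bounded[OF mv] by blast
  have "W T *v u = 0" for u
  proof -
    define w where "w t = W t *v u" for t
    have acw: "abs_cont_deriv w (\<lambda>t. - ((R t ** K t) *v w t))"
      using abs_cont_deriv_linear[OF acW bounded_bilinear.bounded_linear_left[OF mv, of u]]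
      by (rule abs_cont_deriv_cong)
         (auto simp: w_def bounded_bilinear.minus_left[OF mv] matrix_vector_mul_assoc)
    have ac: "abs_cont_deriv (\<lambda>t. w t \<bullet> w t) (\<lambda>t. - 2 * (w t \<bullet> ((R t ** K t) *v w t)))"
      using abs_cont_deriv_bilinear[OF bounded_bilinear_inner acw acw]
      by (rule abs_cont_deriv_cong) (auto simp: inner_commute)
    \<comment> \<open>Gronwall with a negative decay rate: growth of rate at most
      \<open>2 * (L * c)\<close> from the initial value \<open>0\<close> stays
      \<open>0\<close>.\<close>
    have "w T \<bullet> w T \<le> exp (- (- 2 * (L * c)) * (T - 0)) * (w 0 \<bullet> w 0)"
    proof (rule abs_cont_deriv_decay[OF ac order_refl \<open>0 \<le> T\<close>], intro AE_I2 impI)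
      fix t assume t: "0 \<le> t" "t \<le> T"
      have "- (w t \<bullet> ((R t ** K t) *v w t)) \<le> norm (w t) * norm ((R t ** K t) *v w t)"
        using Cauchy_Schwarz_ineq2[of "w t" "(R t ** K t) *v w t"] by linarith
      also have "\<dots> \<le> norm (w t) * (norm (R t ** K t) * norm (w t) * c)"
        by (intro mult_left_mono c) auto
      also have "\<dots> \<le> norm (w t) * (L * norm (w t) * c)"
        using L[OF t] c(1) by (intro mult_left_mono mult_right_mono) auto
      also have "\<dots> = (L * c) * (w t \<bullet> w t)"
        by (simp add: power2_norm_eq_inner[symmetric] power2_eq_square)
      finally show "- 2 * (w t \<bullet> ((R t ** K t) *v w t)) \<le> - (- 2 * (L * c)) * (w t \<bullet> w t)"
        by simp
    qed
    moreover have "w 0 = 0"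
      using \<open>\<mu> > 0\<close> by (simp add: w_def W_def R0 M_def bounded_bilinear.scaleR_left[OF mm]
          bounded_bilinear.scaleR_right[OF mm])
    ultimately have "w T \<bullet> w T \<le> 0" by simp
    then have "w T = 0" by (metis inner_eq_zero_iff inner_ge_zero order_antisym)
    then show ?thesis by (simp add: w_def)
  qed
  then have "W T = 0" by (simp add: matrix_eq)
  then have MR: "M T ** R T = mat 1"
    by (simp add: W_def matrix_left_right_inverse)
  have coercive: "u \<bullet> u / \<mu> \<le> u \<bullet> (M T *v u)" for u
  proof -
    have "bounded_linear (\<lambda>X::real^'k^'k. u \<bullet> (X *v u))"
      using bounded_linear_compose[OF bounded_linear_inner_right bounded_bilinear.bounded_linear_left[OF mv]] .
    from abs_cont_deriv_linear[OF abs_cont_deriv_linear[OF acM this] bounded_linear_minus[OF bounded_linear_ident]]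
    have "- (u \<bullet> (M T *v u)) - - (u \<bullet> (M 0 *v u)) \<le> integral {0..T} (\<lambda>_. 0)"
      by (rule abs_cont_deriv_increase_le) (use \<open>0 \<le> T\<close> psd in auto)
    then show ?thesis by (simp add: M_def scaleR_matrix_vector_assoc[symmetric])
  qed
  \<comment> \<open>Testing coercivity of \<open>M T\<close> at \<open>u\<close> works because
    \<open>M T\<close> maps \<open>u\<close> back to \<open>v\<close>.\<close>
  define u where "u = R T *v v"
  have "M T *v u = v" by (simp add: u_def matrix_vector_mul_assoc MR)
  then have "norm u * norm u \<le> \<mu> * (u \<bullet> v)"
    using coercive[of u] \<open>\<mu> > 0\<close> by (simp add: field_simps power2_norm_eq_inner[symmetric] power2_eq_square)
  also have "\<dots> \<le> \<mu> * (norm u * norm v)"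
    using \<open>\<mu> > 0\<close> norm_cauchy_schwarz by (intro mult_left_mono) auto
  finally have "norm u * norm u \<le> norm u * (\<mu> * norm v)" by (simp add: mult_ac)
  then have "norm u \<le> \<mu> * norm v"
    using \<open>\<mu> > 0\<close> by (cases "u = 0") auto
  then show ?thesis by (simp add: u_def)
qed

section \<open>Error dynamics\<close>

lemma differences_mult: "differences v *v a = (\<Sum>j\<in>UNIV. a $ j *\<^sub>R (v (Some j) - v None))"
  by (simp add: differences_def matrix_vector_mult_def vec_eq_iff mult.commute)

text \<open>The weights sum to one, which eliminates the weight of the last observer and leaves an
  affine expression in \<open>a\<close>.\<close>

lemma combined_eq: "combined a v = differences v *v a + v None"
proof -
  have "combined a v = (1 - (\<Sum>j\<in>UNIV. a $ j)) *\<^sub>R v None + (\<Sum>j\<in>UNIV. a $ j *\<^sub>R v (Some j))"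
    by (simp add: combined_def weight_def UNIV_option_conv sum.reindex)
  then show ?thesis
    by (simp add: differences_mult scaleR_diff_right sum_subtractf scaleR_diff_left scaleR_sum_left)
qed

text \<open>Bounding by the norms of the columns lets the exponential decay of each column pass to
  the whole matrix.\<close>

lemma norm_differences_mult_le:
  "norm (differences v *v a) \<le> (\<Sum>j\<in>UNIV. norm (v (Some j) - v None)) * norm a"
proof -
  have "norm (differences v *v a) \<le> (\<Sum>j\<in>UNIV. norm (a $ j *\<^sub>R (v (Some j) - v None)))"
    unfolding differences_mult by (rule norm_sum)
  also have "\<dots> \<le> (\<Sum>j\<in>UNIV. norm (v (Some j) - v None) * norm a)"
    using component_le_norm_cart[of a] by (intro sum_mono) (simp add: mult.commute mult_right_mono)
  finally show ?thesis by (simp add: sum_distrib_right)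
qed

lemma norm_transpose_differences_mult_le:
  "norm (transpose (differences v) *v w) \<le> (\<Sum>j\<in>UNIV. norm (v (Some j) - v None)) * norm w"
proof -
  have "(transpose (differences v) *v w) $ j = (v (Some j) - v None) \<bullet> w" for j
    by (simp add: matrix_vector_mul_component transpose_def differences_def inner_vec_def)
  then have "norm (transpose (differences v) *v w) \<le> (\<Sum>j\<in>UNIV. \<bar>(v (Some j) - v None) \<bullet> w\<bar>)"
    using norm_le_l1_cart[of "transpose (differences v) *v w"] by simp
  also have "\<dots> \<le> (\<Sum>j\<in>UNIV. norm (v (Some j) - v None) * norm w)"
    by (intro sum_mono Cauchy_Schwarz_ineq2)
  finally show ?thesis by (simp add: sum_distrib_right)
qed

section \<open>Lyapunov estimates for perturbed linear systems\<close>

lemma lyapunov_derivative: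
  assumes "abs_cont_deriv z g" "sym_pos_def P"
  shows "abs_cont_deriv (\<lambda>t. z t \<bullet> (P *v z t)) (\<lambda>t. 2 * (z t \<bullet> (P *v g t)))"
  using abs_cont_deriv_bilinear[OF bounded_bilinear_quadratic_form[of P] assms(1) assms(1)]
proof (rule abs_cont_deriv_cong)
  fix t
  have "g t \<bullet> (P *v z t) = z t \<bullet> (P *v g t)" by (rule sym_pos_def_commute[OF assms(2)])
  then show "z t \<bullet> (P *v g t) + g t \<bullet> (P *v z t) = 2 * (z t \<bullet> (P *v g t))" by simp
qed simp

lemma sym_pos_def_bounds:
  assumes "sym_pos_def P"
  obtains p q where "0 < p" "0 < q" "\<And>v. p * (norm v)\<^sup>2 \<le> v \<bullet> (P *v v)"
    "\<And>v w. \<bar>v \<bullet> (P *v w)\<bar> \<le> q * norm v * norm w" "\<And>v. v \<bullet> (P *v v) \<le> q * (norm v)\<^sup>2"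
proof -
  obtain p where p: "p > 0" "\<And>v. p * (norm v)\<^sup>2 \<le> v \<bullet> (P *v v)"
    using quadratic_form_coercive assms unfolding sym_pos_def_def by blast
  obtain q where q: "q > 0" "\<And>v w. \<bar>v \<bullet> (P *v w)\<bar> \<le> q * norm v * norm w"
    using quadratic_form_bounded by blast
  have "v \<bullet> (P *v v) \<le> q * (norm v)\<^sup>2" for v
    using q(2)[of v v] by (simp add: power2_eq_square mult.assoc)
  with p q show thesis using that by blast
qed

text \<open>As \<open>V = d \<bullet> (P *v d)\<close> is at most \<open>q\<close> times the squared
  norm, it decays at rate \<open>2 * \<kappa>\<close> with \<open>\<kappa> = \<epsilon> / q\<close>.
  Returning to the norm costs the factor \<open>sqrt (q / p)\<close>. Both constants are fixed
  before \<open>d\<close>.\<close>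

lemma lyapunov_exponential_decay:
  fixes Ac P :: "real^'n^'n"
  assumes P: "sym_pos_def P" and "0 < \<epsilon>"
    and dec: "\<And>e. e \<bullet> (P *v (Ac *v e)) \<le> - \<epsilon> * (norm e)\<^sup>2"
  shows "\<exists>c \<kappa>. 0 < c \<and> 0 < \<kappa> \<and> (\<forall>d. abs_cont_deriv d (\<lambda>t. Ac *v d t) \<longrightarrow>
    (\<forall>t\<ge>0. norm (d t) \<le> c * exp (- \<kappa> * t) * norm (d 0)))"
proof -
  obtain p q where pq: "0 < p" "0 < q" "\<And>v. p * (norm v)\<^sup>2 \<le> v \<bullet> (P *v v)"
    "\<And>v. v \<bullet> (P *v v) \<le> q * (norm v)\<^sup>2"
    using sym_pos_def_bounds[OF P] by metis
  define \<kappa> where "\<kappa> = \<epsilon> / q"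
  have "\<kappa> > 0" using \<open>0 < \<epsilon>\<close> pq by (simp add: \<kappa>_def)
  have "norm (d t) \<le> sqrt (q / p) * exp (- \<kappa> * t) * norm (d 0)"
    if d: "abs_cont_deriv d (\<lambda>t. Ac *v d t)" and t: "0 \<le> t" for d t
  proof (rule power2_le_imp_le)
    have "d t \<bullet> (P *v d t) \<le> exp (- (2 * \<kappa>) * (t - 0)) * (d 0 \<bullet> (P *v d 0))"
    proof (rule abs_cont_deriv_decay[OF lyapunov_derivative[OF d P] order_refl t], intro AE_I2 impI)
      fix s
      have "\<kappa> * (d s \<bullet> (P *v d s)) \<le> \<kappa> * (q * (norm (d s))\<^sup>2)"
        using \<open>\<kappa> > 0\<close> pq by (intro mult_left_mono) auto
      also have "\<dots> = \<epsilon> * (norm (d s))\<^sup>2" using pq by (simp add: \<kappa>_def)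
      finally show "2 * (d s \<bullet> (P *v (Ac *v d s))) \<le> - (2 * \<kappa>) * (d s \<bullet> (P *v d s))"
        using dec[of "d s"] by simp
    qed
    also have "\<dots> \<le> exp (- (2 * \<kappa>) * (t - 0)) * (q * (norm (d 0))\<^sup>2)"
      using pq by (intro mult_left_mono) auto
    finally have "p * (norm (d t))\<^sup>2 \<le> exp (- (2 * \<kappa>) * t) * (q * (norm (d 0))\<^sup>2)"
      using pq(3)[of "d t"] by simp
    moreover have "exp (- (2 * \<kappa>) * t) = (exp (- \<kappa> * t))\<^sup>2"
      by (simp add: exp_double[symmetric] algebra_simps)
    ultimately show "(norm (d t))\<^sup>2 \<le> (sqrt (q / p) * exp (- \<kappa> * t) * norm (d 0))\<^sup>2"
      using pq by (simp add: power_mult_distrib field_simps)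
    show "0 \<le> sqrt (q / p) * exp (- \<kappa> * t) * norm (d 0)" using pq by simp
  qed
  moreover have "sqrt (q / p) > 0" using pq by simp
  ultimately show ?thesis using \<open>\<kappa> > 0\<close> by blast
qed

text \<open>The disturbance leads to \<open>V' \<le> - \<kappa> (V - m)\<close>, so \<open>V\<close>
  falls below \<open>1 + m\<close> and then stays there. The level depends on \<open>c\<close> only,
  the waiting time \<open>q * a\<^sup>2 / \<kappa>\<close> on \<open>a\<close>.\<close>

lemma lyapunov_ultimate_bound:
  fixes Ac P :: "real^'n^'n"
  assumes P: "sym_pos_def P" and "0 < \<epsilon>"
    and dec: "\<And>e. e \<bullet> (P *v (Ac *v e)) \<le> - \<epsilon> * (norm e)\<^sup>2"
  shows "\<exists>b>0. \<forall>a>0. \<exists>T\<ge>0. \<forall>z g. abs_cont_deriv z (\<lambda>t. Ac *v z t + g t) \<longrightarrow>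
    (AE t in lebesgue. 0 \<le> t \<longrightarrow> norm (g t) \<le> c) \<longrightarrow>
    (\<forall>t0\<ge>0. norm (z t0) \<le> a \<longrightarrow> (\<forall>t\<ge>t0 + T. norm (z t) \<le> b))"
proof -
  obtain p q where pq: "0 < p" "0 < q" "\<And>v. p * (norm v)\<^sup>2 \<le> v \<bullet> (P *v v)"
    "\<And>v w. \<bar>v \<bullet> (P *v w)\<bar> \<le> q * norm v * norm w" "\<And>v. v \<bullet> (P *v v) \<le> q * (norm v)\<^sup>2"
    using sym_pos_def_bounds[OF P] by metis
  define \<kappa> where "\<kappa> = \<epsilon> / q"
  have "\<kappa> > 0" using \<open>0 < \<epsilon>\<close> pq by (simp add: \<kappa>_def)
  \<comment> \<open>Young's inequality leaves the constant
    \<open>(q * c)\<^sup>2 / \<epsilon>\<close>; it equals \<open>\<kappa> * m\<close>.\<close>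
  define m where "m = (q * c)\<^sup>2 / \<epsilon> / \<kappa>"
  have "m \<ge> 0" using \<open>0 < \<epsilon>\<close> \<open>\<kappa> > 0\<close> by (simp add: m_def)
  define b where "b = sqrt ((1 + m) / p)"
  have "b > 0" using pq \<open>m \<ge> 0\<close> by (simp add: b_def add_pos_nonneg)
  have main: "norm (z t) \<le> b"
    if z: "abs_cont_deriv z (\<lambda>t. Ac *v z t + g t)"
      and g: "AE t in lebesgue. 0 \<le> t \<longrightarrow> norm (g t) \<le> c"
      and t0: "0 \<le> t0" "norm (z t0) \<le> a" and t: "t0 + q * a\<^sup>2 / \<kappa> \<le> t" and a: "0 < a" for z g a t0 t
  proof -
    define V where "V s = z s \<bullet> (P *v z s)" for s
    have "t0 \<le> t" using t \<open>\<kappa> > 0\<close> pq by (smt (verit) divide_nonneg_pos mult_nonneg_nonneg zero_le_power2)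
    have "abs_cont_deriv (\<lambda>s. V s - m) (\<lambda>s. 2 * (z s \<bullet> (P *v (Ac *v z s + g s))) - 0)"
      unfolding V_def by (rule abs_cont_deriv_diff[OF lyapunov_derivative[OF z P] abs_cont_deriv_const])
    then have "V t - m \<le> exp (- \<kappa> * (t - t0)) * (V t0 - m)"
    proof (rule abs_cont_deriv_decay[OF _ t0(1) \<open>t0 \<le> t\<close>])
      show "AE s in lebesgue. t0 \<le> s \<longrightarrow> s \<le> t \<longrightarrow>
        2 * (z s \<bullet> (P *v (Ac *v z s + g s))) - 0 \<le> - \<kappa> * (V s - m)"
        using g
      proof eventually_elim
        case (elim s)
        show ?case
        proof (intro impI)
          assume "t0 \<le> s" "s \<le> t"
          then have gs: "norm (g s) \<le> c" using elim t0(1) by simp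
          have "z s \<bullet> (P *v g s) \<le> q * norm (z s) * norm (g s)" using pq(4)[of "z s" "g s"] by linarith
          also have "\<dots> \<le> q * norm (z s) * c" using gs pq by (intro mult_left_mono) auto
          finally have zg: "z s \<bullet> (P *v g s) \<le> norm (z s) * (q * c)" by (simp add: mult_ac)
          have "0 \<le> (\<epsilon> * norm (z s) - q * c)\<^sup>2" by simp
          then have "2 * (norm (z s) * (q * c)) * \<epsilon> \<le> \<epsilon> * (norm (z s))\<^sup>2 * \<epsilon> + (q * c)\<^sup>2"
            by (simp add: power2_eq_square algebra_simps)
          then have "2 * (norm (z s) * (q * c)) \<le> (\<epsilon> * (norm (z s))\<^sup>2 * \<epsilon> + (q * c)\<^sup>2) / \<epsilon>"
            by (simp only: pos_le_divide_eq[OF \<open>0 < \<epsilon>\<close>])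
          also have "\<dots> = \<epsilon> * (norm (z s))\<^sup>2 + \<kappa> * m"
            using \<open>0 < \<epsilon>\<close> \<open>\<kappa> > 0\<close> by (simp add: m_def add_divide_distrib)
          finally have "2 * (z s \<bullet> (P *v (Ac *v z s + g s))) \<le> - \<epsilon> * (norm (z s))\<^sup>2 + \<kappa> * m"
            using zg dec[of "z s"] by (simp add: matrix_vector_right_distrib inner_add_right)
          moreover have "\<kappa> * V s \<le> \<epsilon> * (norm (z s))\<^sup>2"
          proof -
            have "\<kappa> * V s \<le> \<kappa> * (q * (norm (z s))\<^sup>2)"
              using \<open>\<kappa> > 0\<close> pq unfolding V_def by (intro mult_left_mono) auto
            then show ?thesis using pq by (simp add: \<kappa>_def)
          qed
          ultimately show "2 * (z s \<bullet> (P *v (Ac *v z s + g s))) - 0 \<le> - \<kappa> * (V s - m)"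
            by (simp add: right_diff_distrib)
        qed
      qed
    qed
    also have "\<dots> \<le> exp (- \<kappa> * (t - t0)) * (q * a\<^sup>2)"
    proof (intro mult_left_mono)
      have "V t0 \<le> q * (norm (z t0))\<^sup>2" unfolding V_def by (rule pq)
      also have "\<dots> \<le> q * a\<^sup>2" using t0(2) pq by (intro mult_left_mono power_mono) auto
      finally show "V t0 - m \<le> q * a\<^sup>2" using \<open>m \<ge> 0\<close> by linarith
    qed simp
    \<comment> \<open>The choice of the waiting time together with \<open>y \<le> exp y\<close> for
      \<open>y = q * a\<^sup>2\<close> bounds the transient by \<open>1\<close>.\<close>
    also have "\<dots> \<le> exp (- (q * a\<^sup>2)) * exp (q * a\<^sup>2)"
    proof (intro mult_mono)
      have "q * a\<^sup>2 \<le> \<kappa> * (t - t0)" using t \<open>\<kappa> > 0\<close> by (simp add: field_simps)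
      then show "exp (- \<kappa> * (t - t0)) \<le> exp (- (q * a\<^sup>2))" by simp
      show "q * a\<^sup>2 \<le> exp (q * a\<^sup>2)" using exp_ge_add_one_self[of "q * a\<^sup>2"] by linarith
    qed (use pq in auto)
    also have "\<dots> = 1" by (simp add: exp_minus)
    finally have "V t \<le> 1 + m" by simp
    then have "p * (norm (z t))\<^sup>2 \<le> 1 + m" using pq(3)[of "z t"] by (simp add: V_def)
    then have "(norm (z t))\<^sup>2 \<le> (1 + m) / p" using pq by (simp add: field_simps)
    then show ?thesis unfolding b_def by (rule real_le_rsqrt)
  qed
  show ?thesis
  proof (rule exI[of _ b], intro conjI allI impI)
    fix a :: real assume "0 < a"
    then have "0 \<le> q * a\<^sup>2 / \<kappa>" using pq \<open>\<kappa> > 0\<close> by simp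
    then show "\<exists>T\<ge>0. \<forall>z g. abs_cont_deriv z (\<lambda>t. Ac *v z t + g t) \<longrightarrow>
      (AE t in lebesgue. 0 \<le> t \<longrightarrow> norm (g t) \<le> c) \<longrightarrow>
      (\<forall>t0\<ge>0. norm (z t0) \<le> a \<longrightarrow> (\<forall>t\<ge>t0 + T. norm (z t) \<le> b))"
      using main \<open>0 < a\<close> by blast
  qed (rule \<open>b > 0\<close>)
qed

text \<open>Before \<open>T\<close> the perturbation may exceed \<open>\<epsilon>\<close>, but its
  effect \<open>2 * k * (norm z)\<^sup>2\<close> on \<open>V'\<close> is at most
  \<open>2 * k / p * V\<close>, which is the logarithmic decay rate of \<open>\<phi>\<close> times
  \<open>V\<close>. From \<open>T\<close> on it is at most \<open>\<epsilon> / 2\<close>, and the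
  factor \<open>2\<close> in \<open>V'\<close> restores the full rate \<open>\<epsilon>\<close>. The
  two estimates are glued at \<open>T\<close>.\<close>

lemma lyapunov_vanishing_perturbation:
  fixes P :: "real^'n^'n"
  assumes P: "sym_pos_def P" and "0 < \<epsilon>" and p: "0 < p" "\<And>v. p * (norm v)\<^sup>2 \<le> v \<bullet> (P *v v)"
    and k: "0 \<le> k" and "0 \<le> \<kappa>" and T: "k * exp (- \<kappa> * T) \<le> \<epsilon> / 2"
    and z: "abs_cont_deriv z h"
    and h: "AE t in lebesgue. 0 \<le> t \<longrightarrow> z t \<bullet> (P *v h t) \<le> (- \<epsilon> + k * exp (- \<kappa> * t)) * (norm (z t))\<^sup>2"
    and st: "0 \<le> s" "s \<le> t"
  defines "\<phi> \<equiv> \<lambda>t. exp (2 * k / p * max 0 (T - t))"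
  shows "\<phi> t * (z t \<bullet> (P *v z t)) + \<epsilon> * integral {s..t} (\<lambda>\<tau>. (norm (z \<tau>))\<^sup>2) \<le> \<phi> s * (z s \<bullet> (P *v z s))"
proof -
  define V v where "V t = z t \<bullet> (P *v z t)" and "v t = 2 * (z t \<bullet> (P *v h t))" for t
  have V: "abs_cont_deriv V v" unfolding V_def v_def by (rule lyapunov_derivative[OF z P])
  have ni: "(\<lambda>\<tau>. (norm (z \<tau>))\<^sup>2) integrable_on {s..t}" if "0 \<le> s" for s t
    by (intro integrable_continuous_real continuous_intros continuous_on_subset[OF abs_cont_deriv_continuous[OF z]])
       (use that in auto)
  have late: "V t + \<epsilon> * integral {s..t} (\<lambda>\<tau>. (norm (z \<tau>))\<^sup>2) \<le> V s"
    if "0 \<le> s" "s \<le> t" "T \<le> s" for s t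
  proof -
    have "V t - V s \<le> integral {s..t} (\<lambda>\<tau>. - \<epsilon> * (norm (z \<tau>))\<^sup>2)"
    proof (rule abs_cont_deriv_increase_le[OF V that(1,2)])
      show "AE \<tau> in lebesgue. s \<le> \<tau> \<longrightarrow> \<tau> \<le> t \<longrightarrow> v \<tau> \<le> - \<epsilon> * (norm (z \<tau>))\<^sup>2"
        using h
      proof eventually_elim
        case (elim \<tau>)
        show ?case
        proof (intro impI)
          assume "s \<le> \<tau>" "\<tau> \<le> t"
          then have le: "z \<tau> \<bullet> (P *v h \<tau>) \<le> (- \<epsilon> + k * exp (- \<kappa> * \<tau>)) * (norm (z \<tau>))\<^sup>2"
            using elim that by simp
          have "\<kappa> * T \<le> \<kappa> * \<tau>" using that \<open>s \<le> \<tau>\<close> \<open>0 \<le> \<kappa>\<close> by (intro mult_left_mono) auto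
          then have "k * exp (- \<kappa> * \<tau>) \<le> k * exp (- \<kappa> * T)" using k by (intro mult_left_mono) auto
          then have "(- \<epsilon> + k * exp (- \<kappa> * \<tau>)) * (norm (z \<tau>))\<^sup>2 \<le> (- \<epsilon> / 2) * (norm (z \<tau>))\<^sup>2"
            using T by (intro mult_right_mono) auto
          then show "v \<tau> \<le> - \<epsilon> * (norm (z \<tau>))\<^sup>2" using le by (simp add: v_def)
        qed
      qed
      show "(\<lambda>\<tau>. - \<epsilon> * (norm (z \<tau>))\<^sup>2) integrable_on {s..t}"
        using integrable_cmul[OF ni[OF that(1)], of "- \<epsilon>"] by simp
    qed
    then show ?thesis by simp
  qed
  have early: "\<phi> t * V t + \<epsilon> * integral {s..t} (\<lambda>\<tau>. (norm (z \<tau>))\<^sup>2) \<le> \<phi> s * V s"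
    if st: "0 \<le> s" "s \<le> t" "t \<le> T" for s t
  proof -
    define K where "K = 2 * k / p"
    have "K \<ge> 0" using k p by (simp add: K_def)
    \<comment> \<open>\<open>\<psi>\<close> is \<open>\<phi>\<close> without the maximum, so the
      product rule applies; the two agree up to \<open>T\<close>.\<close>
    define \<psi> where "\<psi> \<tau> = exp (K * T) * exp (- K * \<tau>)" for \<tau>
    have \<psi>: "\<phi> \<tau> = \<psi> \<tau>" if "\<tau> \<le> T" for \<tau>
    proof -
      have "max 0 (T - \<tau>) = T - \<tau>" using that by simp
      then have "\<phi> \<tau> = exp (K * (T - \<tau>))" by (simp only: \<phi>_def K_def)
      then show ?thesis by (simp add: \<psi>_def exp_add[symmetric] right_diff_distrib)
    qed
    have "abs_cont_deriv (\<lambda>\<tau>. \<psi> \<tau> * V \<tau>) (\<lambda>\<tau>. \<psi> \<tau> * v \<tau> + (exp (K * T) * (- K * exp (- K * \<tau>))) * V \<tau>)"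
      unfolding \<psi>_def
      by (rule abs_cont_deriv_bilinear[OF bounded_bilinear_mult
            abs_cont_deriv_linear[OF abs_cont_deriv_exp bounded_linear_mult_right] V])
    then have "\<psi> t * V t - \<psi> s * V s \<le> integral {s..t} (\<lambda>\<tau>. - \<epsilon> * (norm (z \<tau>))\<^sup>2)"
    proof (rule abs_cont_deriv_increase_le[OF _ st(1,2)])
      show "AE \<tau> in lebesgue. s \<le> \<tau> \<longrightarrow> \<tau> \<le> t \<longrightarrow>
        \<psi> \<tau> * v \<tau> + (exp (K * T) * (- K * exp (- K * \<tau>))) * V \<tau> \<le> - \<epsilon> * (norm (z \<tau>))\<^sup>2"
        using h
      proof eventually_elim
        case (elim \<tau>)
        show ?case
        proof (intro impI)
          assume \<tau>: "s \<le> \<tau>" "\<tau> \<le> t"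
          then have le: "z \<tau> \<bullet> (P *v h \<tau>) \<le> (- \<epsilon> + k * exp (- \<kappa> * \<tau>)) * (norm (z \<tau>))\<^sup>2"
            using elim that by simp
          have "k * exp (- \<kappa> * \<tau>) \<le> k" using k \<open>0 \<le> \<kappa>\<close> \<tau> st by (intro mult_left_le) auto
          then have "(- \<epsilon> + k * exp (- \<kappa> * \<tau>)) * (norm (z \<tau>))\<^sup>2 \<le> (- \<epsilon> + k) * (norm (z \<tau>))\<^sup>2"
            by (intro mult_right_mono) auto
          moreover have "2 * k * (norm (z \<tau>))\<^sup>2 \<le> K * V \<tau>"
            using mult_left_mono[OF p(2)[of "z \<tau>"] \<open>K \<ge> 0\<close>] p(1) by (simp add: K_def V_def)
          ultimately have "v \<tau> - K * V \<tau> \<le> - (2 * \<epsilon>) * (norm (z \<tau>))\<^sup>2"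
            using le by (simp add: v_def algebra_simps)
          also have "\<dots> \<le> - \<epsilon> * (norm (z \<tau>))\<^sup>2" using \<open>0 < \<epsilon>\<close> by (intro mult_right_mono) auto
          finally have le1: "v \<tau> - K * V \<tau> \<le> - \<epsilon> * (norm (z \<tau>))\<^sup>2" .
          have "K * (T - \<tau>) \<ge> 0" using \<open>K \<ge> 0\<close> \<tau> st by simp
          \<comment> \<open>A weight of at least \<open>1\<close> does not weaken the negative term
            \<open>- \<epsilon> * (norm (z \<tau>))\<^sup>2\<close>.\<close>
          then have "\<psi> \<tau> \<ge> 1" by (simp add: \<psi>_def exp_add[symmetric] algebra_simps)
          have "\<psi> \<tau> * (v \<tau> - K * V \<tau>) \<le> \<psi> \<tau> * (- \<epsilon> * (norm (z \<tau>))\<^sup>2)"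
            using le1 \<open>\<psi> \<tau> \<ge> 1\<close> by (intro mult_left_mono) auto
          also have "\<dots> \<le> 1 * (- \<epsilon> * (norm (z \<tau>))\<^sup>2)"
            using \<open>\<psi> \<tau> \<ge> 1\<close> \<open>0 < \<epsilon>\<close> by (intro mult_right_mono_neg) auto
          finally show "\<psi> \<tau> * v \<tau> + (exp (K * T) * (- K * exp (- K * \<tau>))) * V \<tau> \<le> - \<epsilon> * (norm (z \<tau>))\<^sup>2"
            by (simp add: \<psi>_def algebra_simps)
        qed
      qed
      show "(\<lambda>\<tau>. - \<epsilon> * (norm (z \<tau>))\<^sup>2) integrable_on {s..t}"
        using integrable_cmul[OF ni[OF st(1)], of "- \<epsilon>"] by simp
    qed
    then show ?thesis using st by (simp add: \<psi>)
  qed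
  have \<phi>1: "\<phi> \<tau> = 1" if "T \<le> \<tau>" for \<tau> using that by (simp add: \<phi>_def)
  have "\<phi> t * V t + \<epsilon> * integral {s..t} (\<lambda>\<tau>. (norm (z \<tau>))\<^sup>2) \<le> \<phi> s * V s"
  proof -
    consider "t \<le> T" | "T \<le> s" | "s \<le> T" "T \<le> t" by linarith
    then show ?thesis
    proof cases
      case 1 then show ?thesis using early st by blast
    next
      case 2 then show ?thesis using late[OF st] \<phi>1 st by simp
    next
      case 3
      have "integral {s..T} (\<lambda>\<tau>. (norm (z \<tau>))\<^sup>2) + integral {T..t} (\<lambda>\<tau>. (norm (z \<tau>))\<^sup>2)
          = integral {s..t} (\<lambda>\<tau>. (norm (z \<tau>))\<^sup>2)"
        using 3 by (intro Henstock_Kurzweil_Integration.integral_combine ni st) auto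
      then have "\<epsilon> * integral {s..t} (\<lambda>\<tau>. (norm (z \<tau>))\<^sup>2) = \<epsilon> * integral {s..T} (\<lambda>\<tau>. (norm (z \<tau>))\<^sup>2)
          + \<epsilon> * integral {T..t} (\<lambda>\<tau>. (norm (z \<tau>))\<^sup>2)"
        by (metis distrib_left)
      moreover have "\<phi> t * V t + \<epsilon> * integral {T..t} (\<lambda>\<tau>. (norm (z \<tau>))\<^sup>2) \<le> \<phi> T * V T"
        using late[of T t] 3 st \<phi>1 by simp
      moreover note early[OF st(1) 3(1) order_refl]
      ultimately show ?thesis by linarith
    qed
  qed
  then show ?thesis by (simp add: V_def)
qed

text \<open>The derivative is dominated by an exponential whose integral over the half-line is
  \<open>c / \<kappa>\<close>.\<close>

lemma abs_cont_deriv_exp_bound: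
  assumes a: "abs_cont_deriv a g" and "0 < \<kappa>" and g: "\<And>t. 0 \<le> t \<Longrightarrow> norm (g t) \<le> c * exp (- \<kappa> * t)"
    and t: "0 \<le> t"
  shows "norm (a t - a 0) \<le> c / \<kappa>"
proof -
  have "0 \<le> c" using order_trans[OF norm_ge_zero g[OF order_refl]] by simp
  have E: "abs_cont_deriv (\<lambda>t. - c / \<kappa> * exp (- \<kappa> * t)) (\<lambda>t. - c / \<kappa> * (- \<kappa> * exp (- \<kappa> * t)))"
    by (rule abs_cont_deriv_linear[OF abs_cont_deriv_exp bounded_linear_mult_right])
  have "norm (a t - a 0) = norm (integral {0..t} g)"
    by (simp add: abs_cont_deriv_diff_eq[OF a order_refl t])
  also have "\<dots> \<le> integral {0..t} (\<lambda>t. - c / \<kappa> * (- \<kappa> * exp (- \<kappa> * t)))"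
  proof (rule integral_norm_bound_integral)
    show "g integrable_on {0..t}" "(\<lambda>t. - c / \<kappa> * (- \<kappa> * exp (- \<kappa> * t))) integrable_on {0..t}"
      using abs_cont_deriv_integrable[OF a order_refl] abs_cont_deriv_integrable[OF E order_refl]
        set_lebesgue_integral_eq_integral(1) by blast+
  qed (use g \<open>0 < \<kappa>\<close> in auto)
  also have "\<dots> = - c / \<kappa> * exp (- \<kappa> * t) - - c / \<kappa> * exp (- \<kappa> * 0)"
    by (rule abs_cont_deriv_diff_eq[OF E order_refl t, symmetric])
  also have "\<dots> \<le> c / \<kappa>" using \<open>0 \<le> c\<close> \<open>0 < \<kappa>\<close> by simp
  finally show ?thesis .
qed

section \<open>Error equations of the closed loop\<close>

text \<open>Subtracting the plant cancels \<open>B u\<close>; subtracting two observers also cancels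
  the common \<open>\<nu>\<close> and the uncertainty. The combined error is
  \<open>E \<alpha>\<close> plus the error of the last observer, and by the product rule the
  adaptation contributes exactly \<open>- E h\<close>.\<close>

lemma closed_loop_error_dynamics:
  fixes A :: "real^'n^'n" and B :: "real^'m^'n" and C :: "real^'n^'p" and D :: "real^'q^'n"
    and Gl Gn :: "real^'p^'n" and xh :: "'k::finite option \<Rightarrow> real \<Rightarrow> real^'n" and R :: "real \<Rightarrow> real^'k^'k"
  assumes cl: "closed_loop A B C D Gl Gn f \<mu> \<xi> u x xh \<alpha> R" and "0 < \<mu>"
  defines "Ac \<equiv> A - Gl ** C" and "E \<equiv> \<lambda>t. differences (\<lambda>i. xh i t)"
    and "e \<equiv> \<lambda>t. combined (\<alpha> t) (\<lambda>i. xh i t) - x t"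
  defines "h \<equiv> \<lambda>t. R t *v (transpose (E t) *v (transpose C *v (C *v e t)))"
  obtains \<nu> where "AE t in lebesgue. 0 \<le> t \<longrightarrow> \<nu> t \<in> filippov f (C *v e t)"
    and "\<And>i. abs_cont_deriv (\<lambda>t. xh i t - x t)
          (\<lambda>t. Ac *v (xh i t - x t) + (Gn *v \<nu> t - D *v \<xi> t (x t) (u t)))"
    and "\<And>j. abs_cont_deriv (\<lambda>t. xh (Some j) t - xh None t) (\<lambda>t. Ac *v (xh (Some j) t - xh None t))"
    and "abs_cont_deriv e (\<lambda>t. Ac *v e t - E t *v h t + (Gn *v \<nu> t - D *v \<xi> t (x t) (u t)))"
    and "abs_cont_deriv \<alpha> (\<lambda>t. - h t)"
    and "\<And>t v. 0 \<le> t \<Longrightarrow> norm (R t *v v) \<le> \<mu> * norm v"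
proof -
  note mv = bounded_bilinear_matrix_vector_mult and mm = bounded_bilinear_matrix_matrix_mult
  let ?d = "\<lambda>j t. xh (Some j) t - xh None t"
  have x: "abs_cont_deriv x (\<lambda>t. A *v x t + B *v u t + D *v \<xi> t (x t) (u t))"
    and \<alpha>: "\<And>t. 0 \<le> t \<Longrightarrow> (\<alpha> has_vector_derivative - ((R t ** transpose (E t) ** transpose C) *v
          ((C ** E t) *v \<alpha> t + (C *v xh None t - C *v x t)))) (at t within {0..})"
    and R: "\<And>t. 0 \<le> t \<Longrightarrow> (R has_vector_derivative
          - (R t ** transpose (E t) ** transpose C ** C ** E t ** R t)) (at t within {0..})"
    and R0: "R 0 = \<mu> *\<^sub>R mat 1"
    using cl unfolding closed_loop_def Let_def caratheodory_iff E_def by blast+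
  obtain \<nu> where \<nu>: "AE t in lebesgue. 0 \<le> t \<longrightarrow>
      \<nu> t \<in> filippov f (combined (\<alpha> t) (\<lambda>i. C *v xh i t - C *v x t))"
    and xh: "\<And>i. abs_cont_deriv (xh i)
      (\<lambda>t. A *v xh i t + B *v u t - Gl *v (C *v xh i t - C *v x t) + Gn *v \<nu> t)"
    using cl unfolding closed_loop_def Let_def caratheodory_iff by blast
  have e: "e t = E t *v \<alpha> t + (xh None t - x t)" for t
    by (simp add: e_def E_def combined_eq)
  \<comment> \<open>The weights sum to one, so combining the output errors subtracts
    \<open>C x\<close> once: the injection is driven by \<open>C e\<close>.\<close>
  have Ce: "combined (\<alpha> t) (\<lambda>i. C *v xh i t - C *v x t) = C *v e t" for t
    by (simp add: e E_def combined_eq differences_mult bounded_bilinear.sum_right[OF mv]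
        bounded_bilinear.diff_right[OF mv] bounded_bilinear.scaleR_right[OF mv]
        bounded_bilinear.add_right[OF mv])
  define w where "w t = Gn *v \<nu> t - D *v \<xi> t (x t) (u t)" for t
  have ei: "abs_cont_deriv (\<lambda>t. xh i t - x t) (\<lambda>t. Ac *v (xh i t - x t) + w t)" for i
    using abs_cont_deriv_diff[OF xh x]
    by (rule abs_cont_deriv_cong)
       (auto simp: Ac_def w_def matrix_vector_mult_diff_rdistrib matrix_vector_mult_diff_distrib
         matrix_vector_mul_assoc[symmetric])
  have d: "abs_cont_deriv (?d j) (\<lambda>t. Ac *v ?d j t)" for j
    using abs_cont_deriv_diff[OF ei[of "Some j"] ei[of None]]
    by (rule abs_cont_deriv_cong) (auto simp: matrix_vector_mult_diff_distrib)
  \<comment> \<open>The bracket, the residual of the least squares problem, is again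
    \<open>C e\<close>.\<close>
  have \<alpha>': "- ((R t ** transpose (E t) ** transpose C) *v
      ((C ** E t) *v \<alpha> t + (C *v xh None t - C *v x t))) = - h t" for t
    unfolding h_def e by (simp only: matrix_vector_mult_diff_distrib matrix_vector_right_distrib matrix_vector_mul_assoc[symmetric])
  have c\<alpha>: "continuous_on {0..} \<alpha>"
    unfolding continuous_on_eq_continuous_within
    using \<alpha> by (auto intro: has_vector_derivative_continuous)
  have cR: "continuous_on {0..} R"
    unfolding continuous_on_eq_continuous_within
    using R by (auto intro: has_vector_derivative_continuous)
  have cxh: "continuous_on {0..} (xh i)" for i by (rule abs_cont_deriv_continuous[OF xh])
  have cE: "continuous_on {0..} E"
    unfolding E_def differences_def by (intro continuous_intros cxh)
  have cET: "continuous_on {0..} (\<lambda>t. transpose (E t))"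
    unfolding transpose_def by (intro continuous_intros cE)
  have ce: "continuous_on {0..} e"
    unfolding e by (intro continuous_intros bounded_bilinear.continuous_on[OF mv cE c\<alpha>]
        cxh abs_cont_deriv_continuous[OF x])
  \<comment> \<open>The law for \<open>\<alpha>\<close> is a pointwise derivative; continuity of its
    right side turns it into integral form.\<close>
  have "continuous_on {0..} h"
    unfolding h_def by (intro bounded_bilinear.continuous_on[OF mv] cR cET ce continuous_on_const)
  then have a: "abs_cont_deriv \<alpha> (\<lambda>t. - h t)"
    using \<alpha> unfolding \<alpha>' by (intro abs_cont_deriv_C1 continuous_on_minus)
  have "abs_cont_deriv (\<lambda>t. (\<Sum>j\<in>UNIV. \<alpha> t $ j *\<^sub>R ?d j t) + (xh None t - x t))
      (\<lambda>t. (\<Sum>j\<in>UNIV. \<alpha> t $ j *\<^sub>R (Ac *v ?d j t) + (- h t) $ j *\<^sub>R ?d j t) + (Ac *v (xh None t - x t) + w t))"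
    by (intro abs_cont_deriv_add abs_cont_deriv_sum ei d abs_cont_deriv_bilinear[OF bounded_bilinear_scaleR]
        abs_cont_deriv_linear[OF a bounded_linear_vec_nth])
  then have ace: "abs_cont_deriv e (\<lambda>t. Ac *v e t - E t *v h t + w t)"
  proof (rule abs_cont_deriv_cong)
    fix t :: real
    show "(\<Sum>j\<in>UNIV. \<alpha> t $ j *\<^sub>R ?d j t) + (xh None t - x t) = e t"
      by (simp add: e E_def differences_mult)
    show "(\<Sum>j\<in>UNIV. \<alpha> t $ j *\<^sub>R (Ac *v ?d j t) + (- h t) $ j *\<^sub>R ?d j t) + (Ac *v (xh None t - x t) + w t)
        = Ac *v e t - E t *v h t + w t"
      by (simp add: e E_def differences_mult sum.distrib sum_subtractf sum_negf matrix_vector_right_distrib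
          bounded_bilinear.sum_right[OF mv] bounded_bilinear.scaleR_right[OF mv])
  qed
  \<comment> \<open>\<open>K\<close> is the Gram matrix of the columns of \<open>C E\<close>, hence
    positive semidefinite.\<close>
  define K where "K t = transpose (E t) ** transpose C ** C ** E t" for t
  have Rb: "norm (R t *v v) \<le> \<mu> * norm v" if "0 \<le> t" for t v
  proof (rule riccati_gain_bound[where K = K])
    show "(R has_vector_derivative - (R t ** K t ** R t)) (at t within {0..})" if "0 \<le> t" for t
      using R[OF that] by (simp add: K_def matrix_mul_assoc)
    show "continuous_on {0..} K"
      unfolding K_def by (intro bounded_bilinear.continuous_on[OF mm] cET cE continuous_on_const)
    show "0 \<le> v \<bullet> (K t *v v)" for t v
      by (simp only: K_def matrix_vector_mul_assoc[symmetric] inner_transpose_left) simp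
  qed (use R0 \<open>0 < \<mu>\<close> that in auto)
  show thesis
    using that[OF \<nu>[unfolded Ce] ei[unfolded w_def] d ace[unfolded w_def] a Rb] .
qed

section \<open>Stability and boundedness of the closed loop\<close>

theorem theorem2:
  fixes A :: "real^'n^'n" and B :: "real^'m^'n" and C :: "real^'n^'p" and D :: "real^'q^'n"
    and J :: "real^'n^'n" and out :: "'p \<Rightarrow> 'n"
    and A22s P2 Q2 :: "real^'p^'p"
    and \<xi>b \<gamma>0 \<rho> \<mu> :: real
    and Gl Gn :: "real^'p^'n"
    and runs :: "((real \<Rightarrow> real^'n) \<times> ('k option \<Rightarrow> real \<Rightarrow> real^'n) \<times> (real \<Rightarrow> real^'k) \<times>
                  (real \<Rightarrow> real^'k^'k)) set"
  assumes "CARD('p) \<ge> CARD('q)"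
    and "full_rank B" and "full_rank C" and "full_rank D"
    and "rank (C ** D) = CARD('q)"
    and "\<And>s. Re s \<ge> 0 \<Longrightarrow> rank (rosenbrock A D C s) = CARD('n) + CARD('q)"
    and "canonical_form A D C J out"
    and "hurwitz A22s" and "sym_pos_def Q2" and "sym_pos_def P2"
    and "P2 ** A22s + transpose A22s ** P2 = - Q2"
    and "\<gamma>0 > 0" and "\<rho> \<ge> \<xi>b + \<gamma>0"
    and "\<mu> > 0"
    and "CARD('k option) \<ge> CARD('n) + 1"
    and "Gl = linear_gain A J out A22s" and "Gn = switching_gain D J out"
    and "runs = closed_loop_runs A B C D Gl Gn (injection P2 \<rho>) \<mu> \<xi>b"
  shows "quadratically_stable (\<lambda>r. {(\<lambda>t. combined (\<alpha> t) (\<lambda>i. xh i t) - x t) | x xh \<alpha> R.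
            (x, xh, \<alpha>, R) \<in> runs \<and> (\<forall>i. norm (xh i 0 - xh None 0) \<le> r)})
       \<and> (\<forall>i X. uniformly_ultimately_bounded {xh i | x xh \<alpha> R.
            (x, xh, \<alpha>, R) \<in> runs \<and> (\<forall>t\<ge>0. norm (x t) \<le> X)})
       \<and> (\<forall>(x, xh, \<alpha>, R)\<in>runs. bounded (\<alpha> ` {0..}) \<and> bounded (R ` {0..}))"
proof -
  define Ac where "Ac = A - Gl ** C"
  obtain P \<epsilon> where P: "sym_pos_def P" and "0 < \<epsilon>"
    and dec: "\<And>e. e \<bullet> (P *v (Ac *v e)) \<le> - \<epsilon> * (norm e)\<^sup>2"
    and slide: "\<And>e \<nu> x. e \<bullet> (P *v (Gn *v \<nu> - D *v x))
      = (C *v e) \<bullet> (P2 *v (onorm ((*v) (out_rows out (J ** D))) *\<^sub>R \<nu> - out_rows out (J ** D) *v x))"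
    using canonical_form_lyapunov[OF assms(7,9,10,11)] unfolding Ac_def assms(16,17) by blast
  obtain p q where pq: "0 < p" "0 < q" "\<And>v. p * (norm v)\<^sup>2 \<le> v \<bullet> (P *v v)"
    "\<And>v w. \<bar>v \<bullet> (P *v w)\<bar> \<le> q * norm v * norm w" "\<And>v. v \<bullet> (P *v v) \<le> q * (norm v)\<^sup>2"
    using sym_pos_def_bounds[OF P] by metis
  obtain c \<kappa> where "0 < c" "0 < \<kappa>"
    and decay: "\<And>d t. abs_cont_deriv d (\<lambda>t. Ac *v d t) \<Longrightarrow> 0 \<le> t \<Longrightarrow> norm (d t) \<le> c * exp (- \<kappa> * t) * norm (d 0)"
    using lyapunov_exponential_decay[OF P \<open>0 < \<epsilon>\<close> dec] by blast
  define cC where "cC = onorm ((*v) (transpose C ** C))"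
  have cC: "norm (transpose C *v (C *v v)) \<le> cC * norm v" for v
    using onorm[of "(*v) (transpose C ** C)" v] unfolding cC_def matrix_vector_mul_assoc by simp
  have "0 \<le> cC" unfolding cC_def by (rule onorm_pos_le) simp
  \<comment> \<open>\<open>S r * exp (- \<kappa> * t)\<close> bounds the sum of the column norms of
    \<open>E\<close>. The absolute value keeps the constants nonnegative for every real
    \<open>r\<close>.\<close>
  define S where "S r = CARD('k) * (c * \<bar>r\<bar>)" for r
  \<comment> \<open>The perturbation \<open>E R E\<^sup>T C\<^sup>T C\<close> contains
    \<open>E\<close> twice: hence the square here and the rate \<open>2 * \<kappa>\<close> below.
    The factor \<open>q\<close> comes from \<open>P\<close>, \<open>\<mu>\<close> from the bound on
    \<open>R\<close>.\<close>
  define k where "k r = q * \<mu> * cC * (S r)\<^sup>2" for r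
  \<comment> \<open>With \<open>y = 2 * k r / \<epsilon>\<close> this makes
    \<open>2 * \<kappa> * T r = y\<close>, and \<open>y * exp (- y) \<le> 1\<close> bounds the
    remaining perturbation by \<open>\<epsilon> / 2\<close>.\<close>
  define T where "T r = k r / (\<epsilon> * \<kappa>)" for r
  define \<phi> where "\<phi> r t = exp (2 * k r / p * max 0 (T r - t))" for r t
  have S: "0 \<le> S r" for r using \<open>0 < c\<close> by (simp add: S_def)
  have k: "0 \<le> k r" for r using pq \<open>\<mu> > 0\<close> \<open>0 \<le> cC\<close> by (simp add: k_def)
  have T: "0 \<le> T r" for r using k \<open>0 < \<epsilon>\<close> \<open>0 < \<kappa>\<close> by (simp add: T_def)
  have kT: "k r * exp (- (2 * \<kappa>) * T r) \<le> \<epsilon> / 2" for r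
  proof -
    define y where "y = 2 * k r / \<epsilon>"
    have "y \<le> exp y" using exp_ge_add_one_self[of y] by linarith
    then have "y * exp (- y) \<le> exp y * exp (- y)" by (rule mult_right_mono) simp
    then have "\<epsilon> / 2 * (y * exp (- y)) \<le> \<epsilon> / 2 * 1"
      using \<open>0 < \<epsilon>\<close> by (intro mult_left_mono) (auto simp: exp_minus)
    moreover have "2 * \<kappa> * T r = y" "\<epsilon> / 2 * y = k r"
      using \<open>0 < \<epsilon>\<close> \<open>0 < \<kappa>\<close> by (simp_all add: T_def y_def)
    ultimately show ?thesis by (simp add: mult.assoc[symmetric])
  qed
  define b0 where "b0 = onorm ((*v) Gn) * \<rho> + onorm ((*v) D) * \<xi>b"
  \<comment> \<open>All constants are fixed before the run, and the initial spread enters only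
    through \<open>r\<close>. This gives the uniformity in the first two claims.\<close>
  have run: "(\<forall>s t. 0 \<le> s \<and> s \<le> t \<longrightarrow>
        \<phi> r t * (e t \<bullet> (P *v e t)) + \<epsilon> * integral {s..t} (\<lambda>\<tau>. (norm (e \<tau>))\<^sup>2) \<le> \<phi> r s * (e s \<bullet> (P *v e s)))
      \<and> (\<forall>i. \<exists>g. abs_cont_deriv (\<lambda>t. xh i t - x t) (\<lambda>t. Ac *v (xh i t - x t) + g t) \<and>
          (AE t in lebesgue. 0 \<le> t \<longrightarrow> norm (g t) \<le> b0))
      \<and> (\<exists>h. abs_cont_deriv \<alpha> h \<and> (\<forall>t\<ge>0. norm (h t) \<le> \<mu> * S r * cC * exp (- \<kappa> * t) * norm (e t)))
      \<and> (\<forall>t\<ge>0. \<forall>v. norm (R t *v v) \<le> \<mu> * norm v)"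
    if in_runs: "(x, xh, \<alpha>, R) \<in> runs" and r: "\<And>j. norm (xh (Some j) 0 - xh None 0) \<le> r"
      and e: "e = (\<lambda>t. combined (\<alpha> t) (\<lambda>i. xh i t) - x t)" for x xh \<alpha> R r e
  proof -
    obtain \<xi> u where \<xi>: "\<And>t a b. norm (\<xi> t a b) \<le> \<xi>b"
      and cl: "closed_loop A B C D Gl Gn (injection P2 \<rho>) \<mu> \<xi> u x xh \<alpha> R"
      using in_runs unfolding assms(18) closed_loop_runs_def by blast
    have "0 \<le> \<xi>b" using order_trans[OF norm_ge_zero \<xi>] .
    then have "0 \<le> \<rho>" "\<xi>b \<le> \<rho>" using assms(12,13) by linarith+
    define E where "E = (\<lambda>t. differences (\<lambda>i. xh i t))"
    define h where "h = (\<lambda>t. R t *v (transpose (E t) *v (transpose C *v (C *v e t))))"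
    obtain \<nu> where \<nu>: "AE t in lebesgue. 0 \<le> t \<longrightarrow> \<nu> t \<in> filippov (injection P2 \<rho>) (C *v e t)"
      and ei: "\<And>i. abs_cont_deriv (\<lambda>t. xh i t - x t)
            (\<lambda>t. Ac *v (xh i t - x t) + (Gn *v \<nu> t - D *v \<xi> t (x t) (u t)))"
      and d: "\<And>j. abs_cont_deriv (\<lambda>t. xh (Some j) t - xh None t) (\<lambda>t. Ac *v (xh (Some j) t - xh None t))"
      and ac: "abs_cont_deriv e (\<lambda>t. Ac *v e t - E t *v h t + (Gn *v \<nu> t - D *v \<xi> t (x t) (u t)))"
      and a: "abs_cont_deriv \<alpha> (\<lambda>t. - h t)"
      and R: "\<And>t v. 0 \<le> t \<Longrightarrow> norm (R t *v v) \<le> \<mu> * norm v"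
      using closed_loop_error_dynamics[OF cl \<open>\<mu> > 0\<close>] unfolding Ac_def E_def h_def e by blast
    have sum_le: "(\<Sum>j\<in>UNIV. norm (xh (Some j) t - xh None t)) \<le> S r * exp (- \<kappa> * t)" if t: "0 \<le> t" for t
    proof -
      have "norm (xh (Some j) t - xh None t) \<le> c * \<bar>r\<bar> * exp (- \<kappa> * t)" for j
      proof -
        have "norm (xh (Some j) t - xh None t) \<le> c * exp (- \<kappa> * t) * norm (xh (Some j) 0 - xh None 0)"
          by (rule decay[OF d t])
        also have "\<dots> \<le> c * exp (- \<kappa> * t) * \<bar>r\<bar>"
          using r[of j] \<open>0 < c\<close> by (intro mult_left_mono) auto
        finally show ?thesis by (simp add: mult_ac)
      qed
      from sum_bounded_above[of UNIV, OF this] show ?thesis by (simp add: S_def mult.assoc)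
    qed
    have ET: "norm (transpose (E t) *v v) \<le> S r * exp (- \<kappa> * t) * norm v"
      and En: "norm (E t *v a) \<le> S r * exp (- \<kappa> * t) * norm a" if "0 \<le> t" for t v a
      using norm_transpose_differences_mult_le[of "\<lambda>i. xh i t" v] norm_differences_mult_le[of "\<lambda>i. xh i t" a]
        mult_right_mono[OF sum_le[OF that], of "norm v"] mult_right_mono[OF sum_le[OF that], of "norm a"]
      unfolding E_def by auto
    have h: "norm (h t) \<le> \<mu> * S r * cC * exp (- \<kappa> * t) * norm (e t)" if t: "0 \<le> t" for t
    proof -
      have "norm (h t) \<le> \<mu> * norm (transpose (E t) *v (transpose C *v (C *v e t)))"
        unfolding h_def by (rule R[OF t])
      also have "\<dots> \<le> \<mu> * (S r * exp (- \<kappa> * t) * norm (transpose C *v (C *v e t)))"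
        using ET[OF t] \<open>\<mu> > 0\<close> by (intro mult_left_mono) auto
      also have "\<dots> \<le> \<mu> * (S r * exp (- \<kappa> * t) * (cC * norm (e t)))"
        using cC S \<open>\<mu> > 0\<close> by (intro mult_left_mono) auto
      finally show ?thesis by (simp add: mult_ac)
    qed
    have energy: "AE t in lebesgue. 0 \<le> t \<longrightarrow>
      e t \<bullet> (P *v (Ac *v e t - E t *v h t + (Gn *v \<nu> t - D *v \<xi> t (x t) (u t))))
        \<le> (- \<epsilon> + k r * exp (- (2 * \<kappa>) * t)) * (norm (e t))\<^sup>2"
      using \<nu>
    proof eventually_elim
      case (elim t)
      show ?case
      proof
        assume t: "0 \<le> t"
        have "norm (\<xi> t (x t) (u t)) \<le> \<rho>" using \<xi> \<open>\<xi>b \<le> \<rho>\<close> order_trans by blast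
        then have "e t \<bullet> (P *v (Gn *v \<nu> t - D *v \<xi> t (x t) (u t))) \<le> 0"
          unfolding slide using elim t by (intro filippov_injection_dissipative[OF assms(10)]) auto
        \<comment> \<open>\<open>E\<close> supplies one decaying factor and \<open>h\<close> the
          other.\<close>
        moreover have "- (e t \<bullet> (P *v (E t *v h t))) \<le> k r * exp (- (2 * \<kappa>) * t) * (norm (e t))\<^sup>2"
        proof -
          have "- (e t \<bullet> (P *v (E t *v h t))) \<le> q * norm (e t) * norm (E t *v h t)"
            using pq(4)[of "e t" "E t *v h t"] by linarith
          also have "\<dots> \<le> q * norm (e t) * (S r * exp (- \<kappa> * t) * norm (h t))"
            using En[OF t] pq by (intro mult_left_mono) auto
          also have "\<dots> \<le> q * norm (e t) * (S r * exp (- \<kappa> * t) * (\<mu> * S r * cC * exp (- \<kappa> * t) * norm (e t)))"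
            using h[OF t] S pq by (intro mult_left_mono) auto
          also have "\<dots> = k r * (exp (- \<kappa> * t) * exp (- \<kappa> * t)) * (norm (e t))\<^sup>2"
            by (simp add: k_def power2_eq_square mult_ac)
          also have "exp (- \<kappa> * t) * exp (- \<kappa> * t) = exp (- (2 * \<kappa>) * t)"
            by (simp add: exp_add[symmetric])
          finally show ?thesis .
        qed
        ultimately show "e t \<bullet> (P *v (Ac *v e t - E t *v h t + (Gn *v \<nu> t - D *v \<xi> t (x t) (u t))))
            \<le> (- \<epsilon> + k r * exp (- (2 * \<kappa>) * t)) * (norm (e t))\<^sup>2"
          using dec[of "e t"]
          by (simp add: matrix_vector_right_distrib matrix_vector_mult_diff_distrib[of P "Ac *v e t"]
              inner_add_right inner_diff_right left_diff_distrib)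
      qed
    qed
    \<comment> \<open>The bound also covers sliding phases, where \<open>\<nu>\<close> is only known
      to lie in the ball of radius \<open>\<rho>\<close>. Neither the control nor the initial state
      enters \<open>b0\<close>.\<close>
    have input_bound: "AE t in lebesgue. 0 \<le> t \<longrightarrow> norm (Gn *v \<nu> t - D *v \<xi> t (x t) (u t)) \<le> b0"
      using \<nu>
    proof eventually_elim
      case (elim t)
      show ?case
      proof
        assume "0 \<le> t"
        then have \<nu>t: "norm (\<nu> t) \<le> \<rho>"
          using elim norm_filippov_injection_le \<open>0 \<le> \<rho>\<close> by blast
        have "norm (Gn *v \<nu> t) \<le> onorm ((*v) Gn) * norm (\<nu> t)"
          "norm (D *v \<xi> t (x t) (u t)) \<le> onorm ((*v) D) * norm (\<xi> t (x t) (u t))"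
          by (intro onorm matrix_vector_mul_bounded_linear)+
        moreover have "onorm ((*v) Gn) * norm (\<nu> t) \<le> onorm ((*v) Gn) * \<rho>"
          "onorm ((*v) D) * norm (\<xi> t (x t) (u t)) \<le> onorm ((*v) D) * \<xi>b"
          by (intro mult_left_mono \<nu>t \<xi> onorm_pos_le matrix_vector_mul_bounded_linear)+
        ultimately show "norm (Gn *v \<nu> t - D *v \<xi> t (x t) (u t)) \<le> b0"
          using norm_triangle_ineq4[of "Gn *v \<nu> t" "D *v \<xi> t (x t) (u t)"] unfolding b0_def by linarith
      qed
    qed
    have "\<forall>i. \<exists>g. abs_cont_deriv (\<lambda>t. xh i t - x t) (\<lambda>t. Ac *v (xh i t - x t) + g t) \<and>
          (AE t in lebesgue. 0 \<le> t \<longrightarrow> norm (g t) \<le> b0)"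
      by (intro allI exI[of _ "\<lambda>t. Gn *v \<nu> t - D *v \<xi> t (x t) (u t)"] conjI ei input_bound)
    moreover have "\<forall>s t. 0 \<le> s \<and> s \<le> t \<longrightarrow>
        \<phi> r t * (e t \<bullet> (P *v e t)) + \<epsilon> * integral {s..t} (\<lambda>\<tau>. (norm (e \<tau>))\<^sup>2) \<le> \<phi> r s * (e s \<bullet> (P *v e s))"
      unfolding \<phi>_def
      using lyapunov_vanishing_perturbation[OF P \<open>0 < \<epsilon>\<close> pq(1,3) k _ kT ac energy] \<open>0 < \<kappa>\<close> by simp
    moreover have "\<exists>h. abs_cont_deriv \<alpha> h \<and> (\<forall>t\<ge>0. norm (h t) \<le> \<mu> * S r * cC * exp (- \<kappa> * t) * norm (e t))"
      using a h by (intro exI[of _ "\<lambda>t. - h t"]) simp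
    ultimately show ?thesis using R by blast
  qed
  have "quadratically_stable (\<lambda>r. {(\<lambda>t. combined (\<alpha> t) (\<lambda>i. xh i t) - x t) | x xh \<alpha> R.
            (x, xh, \<alpha>, R) \<in> runs \<and> (\<forall>i. norm (xh i 0 - xh None 0) \<le> r)})"
    unfolding quadratically_stable_def
  proof (intro exI[of _ P] exI[of _ \<epsilon>] conjI allI P \<open>0 < \<epsilon>\<close>)
    fix r
    have "\<phi> r t \<le> \<phi> r s" if "s \<le> t" for s t
      using that k[of r] pq(1) unfolding \<phi>_def exp_le_cancel_iff by (intro mult_left_mono) auto
    moreover have "continuous_on {0..} (\<phi> r)"
      unfolding \<phi>_def by (intro continuous_intros)
    moreover have "\<phi> r t = 1" if "T r \<le> t" for t using that by (simp add: \<phi>_def)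
    moreover have "\<phi> r t * (z t \<bullet> (P *v z t)) + \<epsilon> * integral {s..t} (\<lambda>\<tau>. (norm (z \<tau>))\<^sup>2)
               \<le> \<phi> r s * (z s \<bullet> (P *v z s))"
      if z: "z \<in> {(\<lambda>t. combined (\<alpha> t) (\<lambda>i. xh i t) - x t) | x xh \<alpha> R.
            (x, xh, \<alpha>, R) \<in> runs \<and> (\<forall>i. norm (xh i 0 - xh None 0) \<le> r)}"
        and st: "0 \<le> s" "s \<le> t" for z s t
    proof -
      obtain x xh \<alpha> R where *: "z = (\<lambda>t. combined (\<alpha> t) (\<lambda>i. xh i t) - x t)" "(x, xh, \<alpha>, R) \<in> runs"
        "\<And>i. norm (xh i 0 - xh None 0) \<le> r"
        using z by blast
      from run[OF *(2,3,1), THEN conjunct1] st show ?thesis by blast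
    qed
    ultimately show "\<exists>(\<phi>::real \<Rightarrow> real) T.
          0 \<le> T \<and> continuous_on {0..} \<phi> \<and> (\<forall>s t. 0 \<le> s \<and> s \<le> t \<longrightarrow> \<phi> t \<le> \<phi> s) \<and>
          (\<forall>t\<ge>T. \<phi> t = 1) \<and>
          (\<forall>z\<in>{(\<lambda>t. combined (\<alpha> t) (\<lambda>i. xh i t) - x t) | x xh \<alpha> R.
            (x, xh, \<alpha>, R) \<in> runs \<and> (\<forall>i. norm (xh i 0 - xh None 0) \<le> r)}.
           \<forall>s t. 0 \<le> s \<and> s \<le> t \<longrightarrow>
             \<phi> t * (z t \<bullet> (P *v z t)) + \<epsilon> * integral {s..t} (\<lambda>\<tau>. (norm (z \<tau>))\<^sup>2)
               \<le> \<phi> s * (z s \<bullet> (P *v z s)))"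
      using T[of r] by (intro exI[of _ "\<phi> r"] exI[of _ "T r"] conjI allI ballI impI) auto
  qed
  moreover have "uniformly_ultimately_bounded {xh i | x xh \<alpha> R.
            (x, xh, \<alpha>, R) \<in> runs \<and> (\<forall>t\<ge>0. norm (x t) \<le> X)}" for i X
  proof -
    obtain b where "0 < b" and b: "\<And>a. 0 < a \<Longrightarrow> \<exists>T\<ge>0. \<forall>z g. abs_cont_deriv z (\<lambda>t. Ac *v z t + g t) \<longrightarrow>
        (AE t in lebesgue. 0 \<le> t \<longrightarrow> norm (g t) \<le> b0) \<longrightarrow>
        (\<forall>t0\<ge>0. norm (z t0) \<le> a \<longrightarrow> (\<forall>t\<ge>t0 + T. norm (z t) \<le> b))"
      using lyapunov_ultimate_bound[OF P \<open>0 < \<epsilon>\<close> dec, of b0] by blast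
    show ?thesis
      unfolding uniformly_ultimately_bounded_def
    \<comment> \<open>The estimate concerns the errors, so the bound on the plant state is added
      once at \<open>t0\<close> and once at the final time.\<close>
    proof (rule exI[of _ "b + \<bar>X\<bar>"], intro conjI allI impI)
      fix a :: real assume "0 < a"
      then have "0 < a + \<bar>X\<bar>" by linarith
      from b[OF this] obtain T where "0 \<le> T" and T: "\<And>z g t0 t. abs_cont_deriv z (\<lambda>t. Ac *v z t + g t) \<Longrightarrow>
          AE t in lebesgue. 0 \<le> t \<longrightarrow> norm (g t) \<le> b0 \<Longrightarrow> 0 \<le> t0 \<Longrightarrow> norm (z t0) \<le> a + \<bar>X\<bar> \<Longrightarrow>
          t0 + T \<le> t \<Longrightarrow> norm (z t) \<le> b" by blast
      have "norm (xh i t) \<le> b + \<bar>X\<bar>"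
        if in_runs: "(x, xh, \<alpha>, R) \<in> runs" and X: "\<And>t. 0 \<le> t \<Longrightarrow> norm (x t) \<le> X"
          and t0: "0 \<le> t0" "norm (xh i t0) \<le> a" "t0 + T \<le> t" for x xh \<alpha> R t0 t
      proof -
        \<comment> \<open>Any \<open>r\<close> bounding the spread of this run will do, because
          \<open>b0\<close> does not depend on \<open>r\<close>.\<close>
        have "norm (xh (Some j) 0 - xh None 0) \<le> (\<Sum>j\<in>UNIV. norm (xh (Some j) 0 - xh None 0))" for j
          by (rule member_le_sum) auto
        from run[OF in_runs this refl] obtain g where
          g: "abs_cont_deriv (\<lambda>t. xh i t - x t) (\<lambda>t. Ac *v (xh i t - x t) + g t)"
            "AE t in lebesgue. 0 \<le> t \<longrightarrow> norm (g t) \<le> b0" by blast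
        have "norm (xh i t0 - x t0) \<le> a + \<bar>X\<bar>"
          using norm_triangle_ineq4[of "xh i t0" "x t0"] X[of t0] t0 by linarith
        from T[OF g t0(1) this t0(3)] have "norm (xh i t - x t) \<le> b" .
        then show ?thesis
          using norm_triangle_ineq[of "xh i t - x t" "x t"] X[of t] t0 \<open>0 \<le> T\<close> by simp
      qed
      then show "\<exists>T\<ge>0. \<forall>z\<in>{xh i | x xh \<alpha> R. (x, xh, \<alpha>, R) \<in> runs \<and> (\<forall>t\<ge>0. norm (x t) \<le> X)}.
          \<forall>t0\<ge>0. norm (z t0) \<le> a \<longrightarrow> (\<forall>t\<ge>t0 + T. norm (z t) \<le> b + \<bar>X\<bar>)"
        using \<open>0 \<le> T\<close> by blast
    qed (use \<open>0 < b\<close> in simp)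
  qed
  moreover have "bounded (\<alpha> ` {0..}) \<and> bounded (R ` {0..})" if in_runs: "(x, xh, \<alpha>, R) \<in> runs" for x xh \<alpha> R
  proof -
    \<comment> \<open>Boundedness is claimed for each run separately, so \<open>r\<close> may depend
      on the run.\<close>
    define r where "r = (\<Sum>j\<in>UNIV. norm (xh (Some j) 0 - xh None 0))"
    define e where "e = (\<lambda>t. combined (\<alpha> t) (\<lambda>i. xh i t) - x t)"
    have "norm (xh (Some j) 0 - xh None 0) \<le> r" for j
      unfolding r_def by (rule member_le_sum) auto
    note * = run[OF in_runs this e_def]
    have R: "norm (R t *v v) \<le> \<mu> * norm v" if "0 \<le> t" for t v using * that by blast
    have "norm (R t) \<le> CARD('k) * (CARD('k) * \<mu>)" if "0 \<le> t" for t
      by (rule norm_matrix_le_of_bound) (rule R[OF that])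
    then have "bounded (R ` {0..})" unfolding bounded_iff by auto
    obtain h where a: "abs_cont_deriv \<alpha> h"
      and h: "\<And>t. 0 \<le> t \<Longrightarrow> norm (h t) \<le> \<mu> * S r * cC * exp (- \<kappa> * t) * norm (e t)" using * by blast
    define V0 where "V0 = \<phi> r 0 * (e 0 \<bullet> (P *v e 0))"
    \<comment> \<open>The weight is at least \<open>1\<close> and the integral nonnegative, so the
      weighted Lyapunov inequality from time \<open>0\<close> bounds \<open>e\<close>
      itself.\<close>
    have eb: "norm (e t) \<le> sqrt (V0 / p)" if t: "0 \<le> t" for t
    proof -
      have "0 \<le> e t \<bullet> (P *v e t)" using pq(1) order_trans[OF _ pq(3)] by simp
      then have "1 * (e t \<bullet> (P *v e t)) \<le> \<phi> r t * (e t \<bullet> (P *v e t))"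
        using k[of r] pq(1) by (intro mult_right_mono) (auto simp: \<phi>_def)
      moreover have "0 \<le> \<epsilon> * integral {0..t} (\<lambda>\<tau>. (norm (e \<tau>))\<^sup>2)"
        \<comment> \<open>The integral of a function that is not integrable is \<open>0\<close> by
          default, so the sign is settled in either case.\<close>
        using \<open>0 < \<epsilon>\<close> by (cases "(\<lambda>\<tau>. (norm (e \<tau>))\<^sup>2) integrable_on {0..t}")
          (auto simp: Henstock_Kurzweil_Integration.integral_nonneg not_integrable_integral)
      moreover have "\<phi> r t * (e t \<bullet> (P *v e t)) + \<epsilon> * integral {0..t} (\<lambda>\<tau>. (norm (e \<tau>))\<^sup>2) \<le> V0"
        unfolding V0_def using * t by blast
      ultimately have "p * (norm (e t))\<^sup>2 \<le> V0" using pq(3)[of "e t"] by linarith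
      then have "(norm (e t))\<^sup>2 \<le> V0 / p" using pq(1) by (simp add: field_simps)
      then show ?thesis by (rule real_le_rsqrt)
    qed
    \<comment> \<open>Since \<open>e\<close> is bounded, the bound on \<open>h\<close> becomes a
      pure exponential with the constant \<open>H\<close>.\<close>
    define H where "H = \<mu> * S r * cC * sqrt (V0 / p)"
    have "norm (h t) \<le> H * exp (- \<kappa> * t)" if t: "0 \<le> t" for t
    proof -
      have "norm (h t) \<le> \<mu> * S r * cC * exp (- \<kappa> * t) * norm (e t)" by (rule h[OF t])
      also have "\<dots> \<le> \<mu> * S r * cC * exp (- \<kappa> * t) * sqrt (V0 / p)"
        using eb[OF t] \<open>\<mu> > 0\<close> S \<open>0 \<le> cC\<close> by (intro mult_left_mono) auto
      finally show ?thesis by (simp add: H_def mult_ac)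
    qed
    from abs_cont_deriv_exp_bound[OF a \<open>0 < \<kappa>\<close> this]
    have "norm (\<alpha> t) \<le> norm (\<alpha> 0) + H / \<kappa>" if "0 \<le> t" for t
      using norm_triangle_ineq[of "\<alpha> t - \<alpha> 0" "\<alpha> 0"] that by fastforce
    then have "bounded (\<alpha> ` {0..})" unfolding bounded_iff by auto
    with \<open>bounded (R ` {0..})\<close> show ?thesis by blast
  qed
  ultimately show ?thesis by auto
qed

end
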